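(* Let $T>0$. Let $g\in C^7(\mathbb{R})$ satisfy $g(x+1)=g(x)$ for all $x\in\mathbb{R}$ and $\int_0^1 g(x)\,dx=0$. Let $f\in C(\mathbb{R})$ be real valued and satisfy $f(t+T)=f(t)$ for all $t\in\mathbb{R}$ and $\int_0^T f(t)\,dt=0$. Then for every $\omega\in(-T,T)$ there exists a family of solutions $X_\xi(t)=(q_\xi(t),p_\xi(t))$, $\xi\in\mathbb{R}$, of the system $$ \dot q=\frac{p}{\sqrt{1+p^2}},\qquad \dot p=g(q)+f(t) $$ such that for all $\xi,t\in\mathbb{R}$ $$ X_{\xi+1}(t)=X_\xi(t)+(1,0)\quad\text{and}\quad X_\xi(t+T)=X_{\xi+\omega}(t). $$ Moreover, the functions $\xi\mapsto q_\xi(0)$ and $\xi\mapsto p_\xi(0)$ are of bounded variation, and for every $\xi\in\mathbb{R}$ $$ \lim_{t\to\infty}\frac{q_\xi(t)}{t}=\frac{\omega}{T}. $$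
   Context: The vector field of the system is bounded, so all solutions are defined for all $t\in\mathbb{R}$. "Of bounded variation" for a function on $\mathbb{R}$ means of bounded variation on every compact interval. *)

theory Defs
  imports "HOL-Analysis.Analysis"
begin

(* Since deriv returns an arbitrary value where a function is not differentiable,
   differentiability of the first k - 1 iterated derivatives has to be required explicitly. *)
definition C_k :: "nat \<Rightarrow> (real \<Rightarrow> real) \<Rightarrow> bool" where
  "C_k k h \<longleftrightarrow>
     (\<forall>j<k. \<forall>x. (deriv ^^ j) h field_differentiable at x) \<and>
     continuous_on UNIV ((deriv ^^ k) h)"

definition solves_system ::
  "(real \<Rightarrow> real) \<Rightarrow> (real \<Rightarrow> real) \<Rightarrow> (real \<Rightarrow> real) \<Rightarrow> (real \<Rightarrow> real) \<Rightarrow> bool" where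
  "solves_system g f q p \<longleftrightarrow>
     (\<forall>t. (q has_real_derivative p t / sqrt (1 + (p t)\<^sup>2)) (at t) \<and>
          (p has_real_derivative g (q t) + f t) (at t))"

definition bounded_variation_on_interval :: "real \<Rightarrow> real \<Rightarrow> (real \<Rightarrow> real) \<Rightarrow> bool" where
  "bounded_variation_on_interval a b h \<longleftrightarrow>
     (\<exists>B. \<forall>(n::nat) (x :: nat \<Rightarrow> real).
        x 0 = a \<and> x n = b \<and> (\<forall>i<n. x i \<le> x (Suc i)) \<longrightarrow>
        (\<Sum>i<n. \<bar>h (x (Suc i)) - h (x i)\<bar>) \<le> B)"

definition locally_bounded_variation :: "(real \<Rightarrow> real) \<Rightarrow> bool" where
  "locally_bounded_variation h \<longleftrightarrow> (\<forall>a b. a \<le> b \<longrightarrow> bounded_variation_on_interval a b h)"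

end

theory Submission
  imports Defs
begin

text \<open>
The system is the Euler--Lagrange equation of the relativistic Lagrangian
\<open>- sqrt (1 - q'^2) + G q - F t * q'\<close>, where \<open>G' = g\<close> and \<open>F' = f\<close>. Both primitives are
periodic because \<open>g\<close> and \<open>f\<close> have mean zero, so the action is invariant under
\<open>q \<mapsto> q + 1\<close> and under \<open>t \<mapsto> t + T\<close>. The proof follows Aubry and Mather, but discretises
time first: only finite sums are minimised, and neither a flow nor its differentiability
with respect to initial data is needed.

For \<open>\<tau> = T / N\<close> consider sequences \<open>x\<close> on the integers with \<open>\<bar>x (i + 1) - x i\<bar> \<le> \<tau>\<close> and
\<open>x (i + s * N) = x i + r\<close>. Minimisers of the discrete action exist by compactness. Their
steps stay strictly below the speed limit, because the action has infinite slope there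
(\<open>minimal_interior\<close>), so they satisfy the discrete Euler--Lagrange equation. The action is
submodular, hence the minimum of two minimisers is a minimiser; two minimisers that touch
without crossing coincide, hence any two are comparable (\<open>minimal_comparable\<close>). Comparing a
minimiser with its translates under the invariance group shows that
\<open>a * (r / s) + b > 0\<close> implies \<open>x i \<le> x (i + a * N) + b\<close> (\<open>minimal_order\<close>). This order
keeps the mean speed over several periods below that of light, uniformly in
\<open>N\<close>, \<open>r\<close>, \<open>s\<close>, which bounds the momenta (\<open>minimal_momentum_bound\<close>).

Minimisers with \<open>N \<rightarrow> \<infinity>\<close> and \<open>r / s\<close> decreasing strictly to \<open>\<omega>\<close> therefore have a
pointwise limit point \<open>q0\<close> (\<open>ordered_trajectory\<close>). It solves the system, because the equation
is expressed by quadratic error bounds on finite increments, which survive pointwise limits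
(\<open>approx_trajectory\<close>). It satisfies \<open>q0 t \<le> q0 (t + a * T) + b\<close> whenever
\<open>a * \<omega> + b > 0\<close>, and also when \<open>a * \<omega> + b = 0\<close> and \<open>a > 0\<close>; the strict approach from above
yields the second case, so that the translates of \<open>q0\<close> form a chain even for rational
\<open>\<omega>\<close>.

Now let \<open>q \<xi> t\<close> be the infimum of \<open>q0 (t + a * T) + b\<close> over all \<open>a\<close>, \<open>b\<close> with
\<open>a * \<omega> + b > \<xi>\<close>. As the infimum of a chain of solutions it is a solution. It is monotone in
\<open>\<xi>\<close>, and both translation laws amount to a shift of the index set. Monotonicity together
with the translation laws gives the mean velocity. Finally, on a short time interval
the difference of two momenta is controlled by the differences of the positions at both ends
(\<open>momentum_controlled_by_positions\<close>); as positions are monotone in \<open>\<xi>\<close>, the momentum has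
bounded variation.
\<close>

section \<open>Periodic functions and derivatives\<close>

lemma antiderivative_periodic:
  fixes h :: "real \<Rightarrow> real"
  assumes cont: "continuous_on UNIV h" and per: "\<And>x. h (x + c) = h x"
    and c: "c > 0" and mean: "integral {0..c} h = 0"
  obtains H where "\<And>x. (H has_real_derivative h x) (at x)" "\<And>x. H (x + c) = H x"
proof -
  \<comment> \<open>The second integral covers negative \<open>x\<close>, where the first one vanishes.\<close>
  define H where "H x = integral {0..x} h - integral {x..0} h" for x
  have int: "h integrable_on {a..b}" for a b
    using cont by (intro integrable_continuous_real) (auto intro: continuous_on_subset)
  have H_diff: "H x = integral {-n..x} h - integral {-n..0} h" if "-n \<le> x" "0 \<le> n" for x n
  proof (cases "0 \<le> x")
    case True
    then show ?thesis
      using Henstock_Kurzweil_Integration.integral_combine[of "-n" 0 x h] int that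
        by (cases "x = 0") (auto simp: H_def)
  next
    case False
    then show ?thesis
      using Henstock_Kurzweil_Integration.integral_combine[of "-n" x 0 h] int that
        by (auto simp: H_def)
  qed
  have deriv: "(H has_real_derivative h x) (at x)" for x
  proof -
    define n where "n = \<bar>x\<bar> + 1"
    have "((\<lambda>u. integral {-n..u} h) has_real_derivative h x) (at x within {-n..n})"
      using cont by (intro integral_has_real_derivative)
        (auto intro: continuous_on_subset simp: n_def)
    then have "((\<lambda>u. integral {-n..u} h) has_real_derivative h x) (at x)"
      by (subst (asm) at_within_interior) (auto simp: n_def)
    then have "((\<lambda>u. integral {-n..u} h - integral {-n..0} h) has_real_derivative h x - 0) (at x)"
      by (intro DERIV_diff DERIV_const)
    then have "((\<lambda>u. integral {-n..u} h - integral {-n..0} h) has_real_derivative h x) (at x)"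
      by simp
    then show ?thesis
    proof (rule DERIV_cong_ev[THEN iffD1, rotated -1, OF _])
      have "eventually (\<lambda>u. u > -n) (nhds x)"
        by (intro eventually_nhds_in_open[of "{-n<..}", simplified]) (auto simp: n_def)
      then show "\<forall>\<^sub>F u in nhds x. integral {- n..u} h - integral {- n..0} h = H u"
        by eventually_elim (subst H_diff[of n], auto simp: n_def)
    qed auto
  qed
  have "H (x + c) = H x" for x
  proof -
    have "((\<lambda>x. H (x + c) - H x) has_real_derivative h (y + c) - h y) (at y)" for y
      by (intro DERIV_diff deriv) (use deriv[of "y + c"] in \<open>simp add: DERIV_shift\<close>)
    then have "((\<lambda>x. H (x + c) - H x) has_real_derivative 0) (at y)" for y
      by (simp add: per)
    then have "H (x + c) - H x = H (0 + c) - H 0"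
      using DERIV_const_ratio_const[of x 0 "\<lambda>x. H (x + c) - H x" 0] by (cases "x = 0") auto
    also have "\<dots> = 0"
      using mean c by (simp add: H_def)
    finally show ?thesis by simp
  qed
  with deriv that show ?thesis by blast
qed

lemma periodic_int:
  fixes h :: "real \<Rightarrow> 'a"
  assumes "\<And>x. h (x + c) = h x"
  shows "h (x + of_int k * c) = h x"
proof -
  have nat: "h (x + real n * c) = h x" for n x
  proof (induction n)
    case (Suc n)
    then show ?case using assms[of "x + real n * c"] by (simp add: algebra_simps)
  qed simp
  show ?thesis
  proof (cases "k \<ge> 0")
    case True
    then show ?thesis using nat[of x "nat k"] by simp
  next
    case False
    then show ?thesis using nat[of "x + of_int k * c" "nat (- k)"] by simp
  qed
qed

lemma periodic_continuous_bounded: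
  fixes h :: "real \<Rightarrow> real"
  assumes cont: "continuous_on UNIV h" and per: "\<And>x. h (x + c) = h x" and c: "c > 0"
  obtains B where "B \<ge> 0" "\<And>x. \<bar>h x\<bar> \<le> B"
proof -
  have "bounded (h ` {0..c})"
    using cont by (intro compact_imp_bounded compact_continuous_image) (auto intro: continuous_on_subset)
  then obtain B where B: "\<And>x. x \<in> {0..c} \<Longrightarrow> \<bar>h x\<bar> \<le> B"
    unfolding bounded_iff by (metis imageI real_norm_def)
  have "\<bar>h x\<bar> \<le> B" for x
  proof -
    have "x + of_int (- \<lfloor>x / c\<rfloor>) * c \<in> {0..c}"
    proof -
      have "of_int \<lfloor>x / c\<rfloor> * c \<le> x"
        using c of_int_floor_le[of "x / c"] by (simp only: pos_le_divide_eq)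
      moreover have "x < (of_int \<lfloor>x / c\<rfloor> + 1) * c"
        using c real_of_int_floor_add_one_gt[of "x / c"] by (simp only: pos_divide_less_eq)
      ultimately show ?thesis by (simp add: algebra_simps)
    qed
    from B[OF this] show ?thesis by (subst (asm) periodic_int[of h c, OF per])
  qed
  moreover have "B \<ge> 0" using B[of 0] c by auto
  ultimately show ?thesis using that by blast
qed

lemma DERIV_bound_imp_Lipschitz:
  fixes h :: "real \<Rightarrow> real"
  assumes "\<And>x. (h has_real_derivative h' x) (at x)" "\<And>x. \<bar>h' x\<bar> \<le> B"
  shows "\<bar>h x - h y\<bar> \<le> B * \<bar>x - y\<bar>"
  using field_differentiable_bound[of UNIV h h' B x y] assms
  by (auto intro: has_field_derivative_at_within)

text \<open>
Differential equations enter below through such bounds on finite increments, since these,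
unlike derivatives, pass to pointwise limits.
\<close>

lemma quadratic_remainder_imp_DERIV:
  fixes h :: "real \<Rightarrow> real"
  assumes "\<And>t'. \<bar>h t' - h t - (t' - t) * d\<bar> \<le> L * (t' - t)\<^sup>2"
  shows "(h has_real_derivative d) (at t)"
proof -
  have "((\<lambda>s. (h (t + s) - h t) / s - d) \<longlongrightarrow> 0) (at 0)"
  proof (rule Lim_null_comparison)
    show "\<forall>\<^sub>F s in at 0. norm ((h (t + s) - h t) / s - d) \<le> \<bar>L\<bar> * \<bar>s\<bar>"
      unfolding eventually_at_filter
    proof (intro always_eventually allI impI)
      fix s :: real assume s: "s \<noteq> 0"
      have "\<bar>(h (t + s) - h t) / s - d\<bar> * \<bar>s\<bar> = \<bar>h (t + s) - h t - s * d\<bar>"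
        using s by (simp add: abs_mult[symmetric] field_simps)
      also have "\<dots> \<le> L * s\<^sup>2" using assms[of "t + s"] by simp
      also have "\<dots> \<le> (\<bar>L\<bar> * \<bar>s\<bar>) * \<bar>s\<bar>"
          by (simp add: power2_eq_square mult.assoc mult_right_mono)
      finally show "norm ((h (t + s) - h t) / s - d) \<le> \<bar>L\<bar> * \<bar>s\<bar>"
        using s by simp
    qed
    show "((\<lambda>s. \<bar>L\<bar> * \<bar>s\<bar>) \<longlongrightarrow> 0) (at 0)"
      by (auto intro!: tendsto_eq_intros)
  qed
  then show ?thesis
    unfolding DERIV_def by (subst (asm) LIM_zero_iff)
qed

section \<open>Functions of bounded variation\<close>

text \<open>
The increments of \<open>m\<close> telescope.
\<close>

lemma mono_bound_imp_bounded_variation: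
  assumes "\<And>x y. x \<le> y \<Longrightarrow> \<bar>h y - h x\<bar> \<le> m y - m x"
  shows "locally_bounded_variation h"
  unfolding locally_bounded_variation_def bounded_variation_on_interval_def
proof (intro allI impI exI)
  fix a b :: real and n :: nat and x :: "nat \<Rightarrow> real"
  assume x: "x 0 = a \<and> x n = b \<and> (\<forall>i<n. x i \<le> x (Suc i))"
  then have "(\<Sum>i<n. \<bar>h (x (Suc i)) - h (x i)\<bar>) \<le> (\<Sum>i<n. m (x (Suc i)) - m (x i))"
    using assms by (intro sum_mono) auto
  also have "\<dots> = m b - m a" using x sum_lessThan_telescope[of "\<lambda>i. m (x i)" n] by simp
  finally show "(\<Sum>i<n. \<bar>h (x (Suc i)) - h (x i)\<bar>) \<le> m b - m a" .
qed

lemma mono_locally_bounded_variation: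
  assumes "mono h"
  shows "locally_bounded_variation h"
  by (rule mono_bound_imp_bounded_variation[of h h]) (use assms in \<open>auto dest: monoD\<close>)

section \<open>Compactness for pointwise convergence\<close>

lemma compact_function_box:
  fixes B :: "'k \<Rightarrow> real"
  shows "compact {x. \<forall>k. \<bar>x k\<bar> \<le> B k}"
proof -
  have "{x. \<forall>k. \<bar>x k\<bar> \<le> B k} = PiE UNIV (\<lambda>k. {- B k..B k})"
    by (auto simp: PiE_def Pi_def extensional_def abs_le_iff minus_le_iff)
  moreover have "compactin (product_topology (\<lambda>i. euclidean) UNIV) (PiE UNIV (\<lambda>k. {- B k..B k}))"
    by (simp add: compactin_PiE)
  ultimately show ?thesis
    by (simp add: euclidean_product_topology)
qed

text \<open>
Tychonoff's theorem. Limits along a finer filter replace the diagonal subsequences that would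
otherwise be needed for uncountably many points \<open>k\<close>.
\<close>

lemma pointwise_cluster:
  fixes X :: "'i \<Rightarrow> 'k \<Rightarrow> real"
  assumes "F \<noteq> bot" and "\<forall>\<^sub>F i in F. \<forall>k. \<bar>X i k\<bar> \<le> B k"
  obtains F' x where "F' \<le> F" "F' \<noteq> bot" "\<And>k. ((\<lambda>i. X i k) \<longlongrightarrow> x k) F'"
proof -
  have "filtermap X F \<noteq> bot" using assms(1) by (simp add: filtermap_bot_iff)
  moreover have "\<forall>\<^sub>F x in filtermap X F. x \<in> {x. \<forall>k. \<bar>x k\<bar> \<le> B k}"
    using assms(2) by (simp add: eventually_filtermap)
  ultimately obtain x where x: "inf (nhds x) (filtermap X F) \<noteq> bot"
    using compact_function_box[of B] unfolding compact_filter by meson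
  define F' where "F' = inf (filtercomap X (nhds x)) F"
  have "F' \<noteq> bot"
  proof
    assume "F' = bot"
    then obtain Q R where "eventually Q (nhds x)" "eventually R F" "\<And>i. Q (X i) \<Longrightarrow> R i \<Longrightarrow> False"
      unfolding F'_def trivial_limit_def eventually_inf eventually_filtercomap by meson
    then have "eventually Q (nhds x)" "eventually (\<lambda>y. \<not> Q y) (filtermap X F)"
      unfolding eventually_filtermap by (simp, elim eventually_mono, metis)
    then have "eventually (\<lambda>_. False) (inf (nhds x) (filtermap X F))"
      unfolding eventually_inf by blast
    with x show False by (simp add: trivial_limit_def)
  qed
  moreover have "(X \<longlongrightarrow> x) F'"
    unfolding F'_def filterlim_def by (metis filtermap_filtercomap filtermap_mono inf_le1 order_trans)
  then have "((\<lambda>i. X i k) \<longlongrightarrow> x k) F'" for k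
    using continuous_on_tendsto_compose[OF continuous_on_product_coordinates[of k] \<open>(X \<longlongrightarrow> x) F'\<close>]
    by simp
  moreover have "F' \<le> F" by (simp add: F'_def)
  ultimately show ?thesis using that by blast
qed

text \<open>
In a chain the lower sections \<open>{v \<in> Q. v \<le> u}\<close> form a filter base. The same filter works at
every point \<open>k\<close>, which is what makes the infimum inherit properties that relate values at different
points.
\<close>

lemma chain_Inf_limit:
  fixes Q :: "('k \<Rightarrow> real) set"
  assumes ne: "Q \<noteq> {}" and chain: "\<And>u v. u \<in> Q \<Longrightarrow> v \<in> Q \<Longrightarrow> u \<le> v \<or> v \<le> u"
    and bdd: "\<And>k. bdd_below ((\<lambda>u. u k) ` Q)"
  obtains F where "F \<noteq> bot" "\<forall>\<^sub>F u in F. u \<in> Q"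
    "\<And>k. ((\<lambda>u. u k) \<longlongrightarrow> (INF u\<in>Q. u k)) F"
proof -
  define F where "F = (INF u\<in>Q. principal {v \<in> Q. v \<le> u})"
  have ev: "eventually P F \<longleftrightarrow> (\<exists>u\<in>Q. \<forall>v\<in>Q. v \<le> u \<longrightarrow> P v)" for P
    unfolding F_def
  proof (subst eventually_INF_base[OF ne])
    fix u v assume uv: "u \<in> Q" "v \<in> Q"
    then have "inf u v \<in> Q" using chain[OF uv] by (auto simp: inf_absorb1 inf_absorb2)
    then show "\<exists>w\<in>Q. principal {v \<in> Q. v \<le> w} \<le> inf (principal {v \<in> Q. v \<le> u}) (principal {w \<in> Q. w \<le> v})"
      by (intro bexI[of _ "inf u v"]) auto
  qed (auto simp: eventually_principal)
  have "F \<noteq> bot" unfolding trivial_limit_def ev by blast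
  moreover have "\<forall>\<^sub>F u in F. u \<in> Q" using ne by (auto simp: ev)
  moreover have "((\<lambda>u. u k) \<longlongrightarrow> (INF u\<in>Q. u k)) F" for k
  proof (rule order_tendstoI)
    fix a assume "a < (INF u\<in>Q. u k)"
    then have "a < u k" if "u \<in> Q" for u using cINF_lower[OF bdd that] by (rule less_le_trans)
    then show "\<forall>\<^sub>F u in F. a < u k" using ne by (auto simp: ev)
  next
    fix a assume "(INF u\<in>Q. u k) < a"
    then obtain u where "u \<in> Q" "u k < a" using cINF_less_iff[OF ne bdd] by blast
    then show "\<forall>\<^sub>F u in F. u k < a" unfolding ev
      by (intro bexI[of _ u]) (auto simp: le_fun_def intro: le_less_trans)
  qed
  ultimately show ?thesis using that by blast
qed

section \<open>Sequences indexed by the integers\<close>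

lemma int_quasiperiodic:
  fixes x :: "int \<Rightarrow> real"
  assumes "\<And>i. x (i + m) = x i + c"
  shows "x (i + k * m) = x i + of_int k * c"
proof -
  have nat: "x (i + int n * m) = x i + real n * c" for n i
  proof (induction n)
    case (Suc n)
    then show ?case using assms[of "i + int n * m"] by (simp add: algebra_simps)
  qed simp
  show ?thesis
  proof (cases "k \<ge> 0")
    case True
    then show ?thesis using nat[of i "nat k"] by simp
  next
    case False
    then show ?thesis using nat[of "i + k * m" "nat (- k)"] by simp
  qed
qed

lemma sum_periodic_window:
  fixes e :: "int \<Rightarrow> real"
  assumes "\<And>i. e (i + m) = e i" "m > 0"
  shows "(\<Sum>i\<in>{k..<k + m}. e i) = (\<Sum>i\<in>{0..<m}. e i)"
proof (rule sum.reindex_bij_witness[where i = "\<lambda>j. k + (j - k) mod m" and j = "\<lambda>i. i mod m"])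
  fix i assume i: "i \<in> {k..<k + m}"
  have "(i mod m - k) mod m = (i - k) mod m" by (simp add: mod_diff_left_eq)
  also have "\<dots> = i - k" using i by (intro mod_pos_pos_trivial) auto
  finally show "k + (i mod m - k) mod m = i" by simp
  show "i mod m \<in> {0..<m}" using assms by auto
  have "e (i mod m + (i div m) * m) = e (i mod m)"
    using int_quasiperiodic[of e m 0 "i mod m" "i div m"] assms by simp
  then show "e (i mod m) = e i" by (simp add: mult.commute)
next
  fix j assume j: "j \<in> {0..<m}"
  have "(k + (j - k) mod m) mod m = j mod m" by (simp add: mod_add_right_eq)
  then show "(k + (j - k) mod m) mod m = j" using j by simp
  show "k + (j - k) mod m \<in> {k..<k + m}" using assms by auto
qed

lemma int_increment_bound:
  fixes u :: "int \<Rightarrow> real"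
  assumes "i \<le> j" and "\<And>k. i \<le> k \<Longrightarrow> k < j \<Longrightarrow> \<bar>u (k + 1) - u k - c\<bar> \<le> e"
  shows "\<bar>u j - u i - of_int (j - i) * c\<bar> \<le> of_int (j - i) * e"
  using assms
proof (induction j rule: int_ge_induct)
  case (step j)
  then have "\<bar>u j - u i - of_int (j - i) * c\<bar> \<le> of_int (j - i) * e" "\<bar>u (j + 1) - u j - c\<bar> \<le> e"
    by auto
  then show ?case by (simp add: algebra_simps)
qed simp

lemma exists_increment_below:
  fixes u :: "int \<Rightarrow> real"
  assumes "u (i + w) - u i < of_int w * c" "w > 0"
  shows "\<exists>j. i \<le> j \<and> j < i + w \<and> u (j + 1) - u j < c"
proof (rule ccontr)
  assume "\<not> ?thesis"
  then have ge: "u (j + 1) - u j \<ge> c" if "i \<le> j" "j < i + w" for j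
    using that by (meson not_less)
  have "u (i + int n) - u i \<ge> of_int n * c" if "int n \<le> w" for n
    using that
  proof (induction n)
    case (Suc n)
    then show ?case using ge[of "i + int n"] by (simp add: algebra_simps)
  qed simp
  from this[of "nat w"] show False using assms by simp
qed

lemma int_increment_bound_sym:
  fixes u :: "int \<Rightarrow> real"
  assumes "\<And>k. min i j \<le> k \<Longrightarrow> k < max i j \<Longrightarrow> \<bar>u (k + 1) - u k - c\<bar> \<le> e"
  shows "\<bar>u j - u i - of_int (j - i) * c\<bar> \<le> of_int \<bar>j - i\<bar> * e"
proof (cases "i \<le> j")
  case True
  then show ?thesis using int_increment_bound[of i j u c e] assms by simp
next
  case False
  then have "\<bar>u i - u j - of_int (i - j) * c\<bar> \<le> of_int (i - j) * e"
    using int_increment_bound[of j i u c e] assms by simp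
  moreover have "\<bar>u j - u i - of_int (j - i) * c\<bar> = \<bar>u i - u j - of_int (i - j) * c\<bar>"
    by (simp add: abs_minus_commute algebra_simps)
  ultimately show ?thesis using False by simp
qed

section \<open>The relativistic velocity\<close>

definition vel :: "real \<Rightarrow> real" where
  "vel p = p / sqrt (1 + p\<^sup>2)"

lemma vel_deriv: "(vel has_real_derivative 1 / sqrt (1 + p\<^sup>2) ^ 3) (at p)"
proof -
  have pos: "1 + p\<^sup>2 > 0" by (simp add: add_pos_nonneg)
  then have "sqrt (1 + p\<^sup>2) > 0" "(sqrt (1 + p\<^sup>2))\<^sup>2 = 1 + p\<^sup>2" by simp_all
  then show ?thesis unfolding vel_def using pos
    by (auto intro!: derivative_eq_intros simp: field_simps power2_eq_square power3_eq_cube)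
qed

lemma vel_mean_value:
  assumes "\<bar>a\<bar> \<le> B" "\<bar>b\<bar> \<le> B"
  obtains c where "1 / sqrt (1 + B\<^sup>2) ^ 3 \<le> c" "c \<le> 1" "vel b - vel a = c * (b - a)"
proof -
  have slope: "1 / sqrt (1 + B\<^sup>2) ^ 3 \<le> 1 / sqrt (1 + z\<^sup>2) ^ 3 \<and> 1 / sqrt (1 + z\<^sup>2) ^ 3 \<le> 1"
    if "\<bar>z\<bar> \<le> B" for z
  proof -
    have "z\<^sup>2 \<le> B\<^sup>2" using that by (meson abs_le_square_iff abs_ge_self order_trans)
    then have "sqrt (1 + z\<^sup>2) ^ 3 \<le> sqrt (1 + B\<^sup>2) ^ 3" by (intro power_mono) auto
    moreover have "1 \<le> sqrt (1 + z\<^sup>2) ^ 3" by (intro one_le_power) simp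
    moreover have "sqrt (1 + B\<^sup>2) > 0" "sqrt (1 + z\<^sup>2) > 0" by (simp_all add: add_pos_nonneg)
    ultimately show ?thesis by (simp add: frac_le)
  qed
  have main: "\<exists>c. 1 / sqrt (1 + B\<^sup>2) ^ 3 \<le> c \<and> c \<le> 1 \<and> vel b - vel a = c * (b - a)"
    if ab: "a < b" "\<bar>a\<bar> \<le> B" "\<bar>b\<bar> \<le> B" for a b
  proof -
    obtain z where z: "z > a" "z < b" "vel b - vel a = (b - a) * (1 / sqrt (1 + z\<^sup>2) ^ 3)"
      using MVT2[OF ab(1), of vel "\<lambda>z. 1 / sqrt (1 + z\<^sup>2) ^ 3"] vel_deriv by blast
    then show ?thesis using slope[of z] ab by (intro exI[of _ "1 / sqrt (1 + z\<^sup>2) ^ 3"]) auto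
  qed
  consider "a < b" | "b < a" | "a = b" by linarith
  then show ?thesis
  proof cases
    case 1
    then show ?thesis using main[of a b] assms that by blast
  next
    case 2
    then obtain c where "1 / sqrt (1 + B\<^sup>2) ^ 3 \<le> c" "c \<le> 1" "vel a - vel b = c * (a - b)"
      using main[of b a] assms by blast
    then show ?thesis by (intro that[of c]) (auto simp: algebra_simps)
  next
    case 3
    then show ?thesis using slope[of B] assms by (intro that[of 1]) (auto intro: order_trans)
  qed
qed

lemma vel_Lipschitz: "\<bar>vel b - vel a\<bar> \<le> \<bar>b - a\<bar>"
proof -
  define B where "B = max \<bar>a\<bar> \<bar>b\<bar>"
  have "1 / sqrt (1 + B\<^sup>2) ^ 3 > 0" by (simp add: add_pos_nonneg)
  moreover obtain c where "1 / sqrt (1 + B\<^sup>2) ^ 3 \<le> c" "c \<le> 1" "vel b - vel a = c * (b - a)"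
    using vel_mean_value[of a B b] by (auto simp: B_def)
  ultimately have "\<bar>c\<bar> \<le> 1" "vel b - vel a = c * (b - a)" by linarith+
  then show ?thesis by (simp add: abs_mult mult_left_le_one_le)
qed

lemma vel_strict_mono: "strict_mono vel"
proof (rule strict_monoI)
  fix a b :: real assume "a < b"
  moreover have "1 / sqrt (1 + p\<^sup>2) ^ 3 > 0" for p :: real by (simp add: add_pos_nonneg)
  ultimately show "vel a < vel b" using vel_deriv by (blast intro: DERIV_pos_imp_increasing)
qed

lemma vel_bound: "\<bar>vel p\<bar> < 1"
proof -
  have "\<bar>p\<bar> < sqrt (1 + p\<^sup>2)" by (rule real_less_rsqrt) simp
  moreover have "sqrt (1 + p\<^sup>2) > 0" by (simp add: add_pos_nonneg)
  ultimately show ?thesis by (simp add: vel_def)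
qed

section \<open>Minimisers of the discrete action\<close>

text \<open>
Sequences \<open>x\<close> represent positions at the times \<open>i * \<tau>\<close>, and \<open>F i\<close> is the value of
the primitive of the forcing at that time. The condition \<open>slow\<close> says that a sequence which
advances by \<open>r\<close> in \<open>M\<close> steps cannot run at the speed limit throughout; \<open>M \<ge> 2\<close> makes
consecutive sites independent.
\<close>

locale periodic_action =
  fixes \<tau> :: real and G g :: "real \<Rightarrow> real" and A :: real
    and F :: "int \<Rightarrow> real" and M r :: int
  assumes tau_pos: "\<tau> > 0"
    and G_deriv: "(G has_real_derivative g a) (at a)"
    and g_bound: "\<bar>g a\<bar> \<le> A"
    and G_periodic: "G (a + 1) = G a"
    and F_periodic: "F (i + M) = F i"
    and M_ge_2: "M \<ge> 2"
    and slow: "\<bar>of_int r\<bar> < of_int M * \<tau>"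
begin

definition config :: "(int \<Rightarrow> real) set" where
  "config = {x. (\<forall>i. x (i + M) = x i + of_int r) \<and> (\<forall>i. \<bar>x (i + 1) - x i\<bar> \<le> \<tau>)}"

text \<open>
The Lagrangian times \<open>\<tau>\<close>. The forcing enters through \<open>- F i * (b - a)\<close> instead of
\<open>\<tau> * f * a\<close>, from which it differs by a summation by parts, so that each bond is exactly invariant
under integer translations.
\<close>

definition bond :: "int \<Rightarrow> real \<Rightarrow> real \<Rightarrow> real" where
  "bond i a b = \<tau> * G a - sqrt (\<tau>\<^sup>2 - (b - a)\<^sup>2) - F i * (b - a)"

definition action :: "(int \<Rightarrow> real) \<Rightarrow> real" where
  "action x = (\<Sum>i\<in>{0..<M}. bond i (x i) (x (i + 1)))"

definition minimal :: "(int \<Rightarrow> real) \<Rightarrow> bool" where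
  "minimal x \<longleftrightarrow> x \<in> config \<and> (\<forall>y\<in>config. action x \<le> action y)"

lemma configD:
  assumes "x \<in> config"
  shows "x (i + M) = x i + of_int r" "\<bar>x (i + 1) - x i\<bar> \<le> \<tau>"
    "x (i + k * M) = x i + of_int k * of_int r"
  using assms int_quasiperiodic[of x M "of_int r" i k] by (auto simp: config_def)

lemma G_int: "G (a + of_int k) = G a"
  using periodic_int[of G 1 a k] G_periodic by simp

lemma bond_shift: "bond i (a + of_int k) (b + of_int k) = bond i a b"
  by (simp add: bond_def G_int)

lemma action_window:
  assumes "x \<in> config"
  shows "action x = (\<Sum>i\<in>{k..<k + M}. bond i (x i) (x (i + 1)))"
proof -
  have "bond (i + M) (x (i + M)) (x (i + M + 1)) = bond i (x i) (x (i + 1))" for i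
  proof -
    have "x (i + M + 1) = x (i + 1) + of_int r" using configD(1)[OF assms, of "i + 1"] by (simp add: ac_simps)
    then have "bond (i + M) (x (i + M)) (x (i + M + 1)) = bond (i + M) (x i) (x (i + 1))"
      by (simp only: configD(1)[OF assms] bond_shift)
    then show ?thesis by (simp add: bond_def F_periodic)
  qed
  then show ?thesis unfolding action_def
    using sum_periodic_window[of "\<lambda>i. bond i (x i) (x (i + 1))" M k] M_ge_2 by simp
qed

lemma config_translate:
  assumes "x \<in> config"
  shows "(\<lambda>i. x (i + n) + of_int b) \<in> config"
  using configD(1)[OF assms, of "_ + n"] configD(2)[OF assms, of "_ + n"]
  by (auto simp: config_def ac_simps)

lemma action_translate:
  assumes x: "x \<in> config" and n: "\<And>i. F (i + n) = F i"
  shows "action (\<lambda>i. x (i + n) + of_int b) = action x"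
proof -
  have "action (\<lambda>i. x (i + n) + of_int b) = (\<Sum>i\<in>{0..<M}. bond (i + n) (x (i + n)) (x (i + n + 1)))"
    unfolding action_def bond_shift by (simp add: bond_def n ac_simps)
  also have "\<dots> = (\<Sum>i\<in>{n..<n + M}. bond i (x i) (x (i + 1)))"
    by (rule sum.reindex_bij_witness[where i = "\<lambda>i. i - n" and j = "\<lambda>i. i + n"]) auto
  also have "\<dots> = action x" by (rule action_window[OF x, symmetric])
  finally show ?thesis .
qed

lemma minimal_translate:
  assumes "minimal x" and "\<And>i. F (i + n) = F i"
  shows "minimal (\<lambda>i. x (i + n) + of_int b)"
  using assms config_translate action_translate unfolding minimal_def by simp

lemma config_growth:
  assumes "x \<in> config"
  shows "\<bar>x i - x j\<bar> \<le> of_int \<bar>i - j\<bar> * \<tau>"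
proof -
  have nat: "\<bar>x (j + int n) - x j\<bar> \<le> real n * \<tau>" for n j
  proof (induction n)
    case (Suc n)
    then show ?case using configD(2)[OF assms, of "j + int n"] by (simp add: algebra_simps)
  qed simp
  show ?thesis
  proof (cases "i \<ge> j")
    case True
    then show ?thesis using nat[of j "nat (i - j)"] by simp
  next
    case False
    then show ?thesis using nat[of i "nat (j - i)"] by simp
  qed
qed

text \<open>
Integer translations preserve the action, so it suffices to minimise over the sequences with
\<open>x 0 \<in> {0..1}\<close>, which form a compact set for pointwise convergence.
\<close>

lemma minimal_exists:
  obtains x where "minimal x" "x 0 \<in> {0..1}"
proof -
  define C where "C = {x \<in> config. x 0 \<in> {0..1}}"
  define Bx where "Bx = {x. \<forall>i. \<bar>x i\<bar> \<le> (\<lambda>i. 1 + of_int \<bar>i\<bar> * \<tau>) i}"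
  have coord: "continuous_on UNIV (\<lambda>x. x i :: real)" for i :: int
    by (rule continuous_on_product_coordinates)
  have 1: "closed {x. x (i + M) = x i + real_of_int r}" for i
    by (intro closed_Collect_eq[of "\<lambda>x. x (i + M)" "\<lambda>x. x i + real_of_int r"]
        continuous_on_add[OF coord continuous_on_const] coord)
  have 2: "closed {x. \<bar>x (i + 1) - x i\<bar> \<le> \<tau>}" for i :: int
    by (intro closed_Collect_le[of "\<lambda>x. \<bar>x (i + 1) - x i\<bar>" "\<lambda>x. \<tau>"]
        continuous_on_rabs[OF continuous_on_diff[OF coord coord]] continuous_on_const)
  have 3: "closed {x :: int \<Rightarrow> real. 0 \<le> x 0}"
    by (rule closed_Collect_le[of "\<lambda>x. 0" "\<lambda>x. x 0", OF continuous_on_const coord])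
  have 4: "closed {x :: int \<Rightarrow> real. x 0 \<le> 1}"
    by (rule closed_Collect_le[of "\<lambda>x. x 0" "\<lambda>x. 1", OF coord continuous_on_const])
  have "C = (\<Inter>i. {x. x (i + M) = x i + real_of_int r}) \<inter> ((\<Inter>i. {x. \<bar>x (i + 1) - x i\<bar> \<le> \<tau>})
      \<inter> ({x. 0 \<le> x 0} \<inter> {x. x 0 \<le> 1}))"
    unfolding C_def config_def atLeastAtMost_iff
    by (rule set_eqI) (simp only: Int_iff INT_iff mem_Collect_eq UNIV_I simp_thms ball_UNIV conj_assoc)
  then have "closed C" by (simp only:) (intro closed_Int closed_INT ballI 1 2 3 4)
  moreover have "compact Bx" unfolding Bx_def by (rule compact_function_box)
  moreover have "C \<subseteq> Bx"
  proof
    fix x assume "x \<in> C"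
    then show "x \<in> Bx" using config_growth[of x _ 0] unfolding C_def Bx_def
      by (auto simp: abs_le_iff) (smt (verit))+
  qed
  ultimately have "compact C" by (metis closed_Int_compact inf.absorb1)
  moreover have "C \<noteq> {}"
  proof -
    define c where "c = of_int r / real_of_int M"
    have "\<bar>c\<bar> < \<tau>" using slow M_ge_2 by (simp add: c_def pos_divide_less_eq mult.commute)
    moreover have "of_int M * c = of_int r" using M_ge_2 by (simp add: c_def)
    ultimately have "(\<lambda>i. of_int i * c) \<in> C"
      unfolding C_def config_def by (simp add: distrib_right)
    then show ?thesis by blast
  qed
  moreover have "continuous_on C action" 
  proof -
    have "continuous_on UNIV G"
      using G_deriv by (intro DERIV_continuous_on) (auto intro: has_field_derivative_at_within)
    then have G: "continuous_on C (\<lambda>x. G (x i))" for i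
      by (rule continuous_on_compose2) (auto intro: continuous_on_product_coordinates continuous_on_subset)
    have c: "continuous_on C (\<lambda>x. x i)" for i :: int
      using coord continuous_on_subset by blast
    have "continuous_on C (\<lambda>x. bond i (x i) (x (i + 1)))" for i
      unfolding bond_def
      by (intro continuous_on_diff continuous_on_mult continuous_on_const
          continuous_on_real_sqrt continuous_on_power G c)
    then show ?thesis unfolding action_def by (rule continuous_on_sum)
  qed
  ultimately obtain x where x: "x \<in> C" and min: "\<And>y. y \<in> C \<Longrightarrow> action x \<le> action y"
    using continuous_attains_inf[of C action] by blast
  have "action x \<le> action y" if y: "y \<in> config" for y
  proof -
    define z where "z = (\<lambda>i. y (i + 0) + of_int (- \<lfloor>y 0\<rfloor>))"
    have "z \<in> config" unfolding z_def by (rule config_translate[OF y])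
    moreover have "z 0 \<in> {0..1}" using floor_correct[of "y 0"] by (simp add: z_def) linarith
    ultimately have "action x \<le> action z" using min by (simp add: C_def)
    also have "\<dots> = action y" unfolding z_def by (rule action_translate[OF y]) simp
    finally show ?thesis .
  qed
  with x that show ?thesis unfolding minimal_def C_def by blast
qed

text \<open>
Replacing \<open>x j\<close> by \<open>y\<close>, and all sites congruent to \<open>j\<close> modulo \<open>M\<close> accordingly, changes only
two bonds of one period.
\<close>

lemma minimal_site:
  assumes x: "minimal x" and y: "\<bar>y - x (j - 1)\<bar> \<le> \<tau>" "\<bar>x (j + 1) - y\<bar> \<le> \<tau>"
  shows "bond (j - 1) (x (j - 1)) (x j) + bond j (x j) (x (j + 1))
       \<le> bond (j - 1) (x (j - 1)) y + bond j y (x (j + 1))"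
proof -
  have xc: "x \<in> config" using x by (simp add: minimal_def)
  define z where "z i = (if M dvd i - j then x i + (y - x j) else x i)" for i
  have "z \<in> config" unfolding config_def
  proof (intro CollectI conjI allI)
    fix i
    have "M dvd (i + M) - j \<longleftrightarrow> M dvd i - j"
      by (metis add_diff_eq diff_add_eq dvd_add_triv_right_iff)
    then show "z (i + M) = z i + of_int r" using configD(1)[OF xc] by (simp add: z_def)
    have dvd: "\<not> (M dvd i - j \<and> M dvd i + 1 - j)"
    proof
      assume "M dvd i - j \<and> M dvd i + 1 - j"
      then have "M dvd (i + 1 - j) - (i - j)" by (elim conjE) (rule dvd_diff)
      then show False using M_ge_2 by (auto dest: zdvd_imp_le)
    qed
    consider "M dvd i - j" | "M dvd i + 1 - j" | "\<not> M dvd i - j" "\<not> M dvd i + 1 - j" by blast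
    then show "\<bar>z (i + 1) - z i\<bar> \<le> \<tau>"
    proof cases
      case 1
      then obtain k where "i = j + k * M" by (metis add.commute diff_add_cancel dvd_def mult.commute)
      then have "x i = x j + of_int k * of_int r" "x (i + 1) = x (j + 1) + of_int k * of_int r"
        using configD(3)[OF xc, of j k] configD(3)[OF xc, of "j + 1" k] by (simp_all add: ac_simps)
      then show ?thesis using 1 dvd y by (simp add: z_def)
    next
      case 2
      then obtain k where "i + 1 - j = k * M" by (metis dvd_def mult.commute)
      then have i: "i = (j - 1) + k * M" "i + 1 = j + k * M" by simp_all
      have "x i = x (j - 1) + of_int k * of_int r"
        unfolding i(1) by (rule configD(3)[OF xc])
      moreover have "x (i + 1) = x j + of_int k * of_int r"
        unfolding i(2) by (rule configD(3)[OF xc])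
      ultimately show ?thesis using 2 dvd y by (simp add: z_def)
    next
      case 3
      then show ?thesis using configD(2)[OF xc] by (simp add: z_def)
    qed
  qed
  then have "action x \<le> action z" using x by (simp add: minimal_def)
  moreover have split: "action w = bond (j - 1) (w (j - 1)) (w j) + (bond j (w j) (w (j + 1))
      + (\<Sum>i\<in>{j + 1..<j - 1 + M}. bond i (w i) (w (i + 1))))" if "w \<in> config" for w
  proof -
    have "{j - 1..<j - 1 + M} = insert (j - 1) (insert j {j + 1..<j - 1 + M})" using M_ge_2 by auto
    then show ?thesis using action_window[OF that, of "j - 1"] by simp
  qed
  moreover have nd: "\<not> M dvd k" if "0 < k" "k < M" for k
    using that by (auto dest: zdvd_imp_le)
  have "(\<Sum>i\<in>{j + 1..<j - 1 + M}. bond i (z i) (z (i + 1))) = (\<Sum>i\<in>{j + 1..<j - 1 + M}. bond i (x i) (x (i + 1)))"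
    using nd by (intro sum.cong) (auto simp: z_def)
  moreover have "z (j - 1) = x (j - 1)" "z (j + 1) = x (j + 1)" "z j = y"
    using M_ge_2 nd[of 1] by (auto simp: z_def)
  ultimately show ?thesis using split[OF xc] split[OF \<open>z \<in> config\<close>] by simp
qed

end

text \<open>
A step of size \<open>\<tau>\<close> is at the speed limit. Shortening it by \<open>\<epsilon>\<close> gains a multiple of
\<open>sqrt \<epsilon>\<close>, whereas the simultaneous change of a step \<open>b < \<tau>\<close> and of all Lipschitz terms
costs at most a multiple of \<open>\<epsilon>\<close>.
\<close>

lemma sqrt_gain:
  fixes \<tau> b L :: real
  assumes "\<tau> > 0" "\<bar>b\<bar> \<le> \<tau>" "b < \<tau>" "L \<ge> 0"
  obtains \<epsilon> where "\<epsilon> > 0" "\<epsilon> \<le> \<tau>" "b + \<epsilon> \<le> \<tau>"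
    "sqrt (\<tau>\<^sup>2 - b\<^sup>2) + L * \<epsilon> < sqrt (\<tau>\<^sup>2 - (\<tau> - \<epsilon>)\<^sup>2) + sqrt (\<tau>\<^sup>2 - (b + \<epsilon>)\<^sup>2)"
proof -
  \<comment> \<open>\<open>L' * \<epsilon>\<close> bounds the total cost of the move; the last bound on \<open>\<epsilon>\<close> makes it
    smaller than the gain \<open>sqrt (\<tau> * \<epsilon>)\<close>.\<close>
  define L' where "L' = L + \<tau> / (\<tau> - b)"
  define \<epsilon> where "\<epsilon> = min (min \<tau> (\<tau> - b)) (\<tau> / (L'\<^sup>2 + 1))"
  have L1: "L'\<^sup>2 + 1 > 0" by (simp add: add_nonneg_pos)
  have eps: "\<epsilon> > 0" "\<epsilon> \<le> \<tau>" "b + \<epsilon> \<le> \<tau>" using assms L1 by (auto simp: \<epsilon>_def)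
  have "\<epsilon> * (L'\<^sup>2 + 1) \<le> \<tau>"
    using L1 by (simp add: \<epsilon>_def pos_le_divide_eq[symmetric])
  then have "L'\<^sup>2 * \<epsilon> < \<tau>" using eps by (simp add: algebra_simps)
  then have "L' * \<epsilon> < sqrt (\<tau> * \<epsilon>)"
    using eps by (intro real_less_rsqrt) (simp add: power_mult_distrib power2_eq_square)
  also have "\<epsilon> * \<epsilon> \<le> \<tau> * \<epsilon>" using eps by simp
  then have "sqrt (\<tau> * \<epsilon>) \<le> sqrt (\<tau>\<^sup>2 - (\<tau> - \<epsilon>)\<^sup>2)"
    by (simp add: power2_eq_square algebra_simps)
  finally have first: "L' * \<epsilon> < sqrt (\<tau>\<^sup>2 - (\<tau> - \<epsilon>)\<^sup>2)" .
  define \<theta> where "\<theta> = \<epsilon> / (\<tau> - b)"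
  have th: "0 \<le> \<theta>" "\<theta> \<le> 1" "\<theta> * (\<tau> - b) = \<epsilon>" using eps assms by (auto simp: \<theta>_def)
  have "sqrt (\<tau>\<^sup>2 - b\<^sup>2) \<le> \<tau>" using assms by (intro real_le_lsqrt) auto
  then have "sqrt (\<tau>\<^sup>2 - b\<^sup>2) * \<theta> \<le> \<tau> * \<theta>" using th by (intro mult_right_mono)
  moreover have "sqrt (\<tau>\<^sup>2 - b\<^sup>2) * (1 - \<theta>) \<le> sqrt (\<tau>\<^sup>2 - (b + \<epsilon>)\<^sup>2)"
  proof (rule real_le_rsqrt)
    have sq: "b\<^sup>2 \<le> \<tau>\<^sup>2" using assms by (simp add: abs_le_square_iff[symmetric])
    have "(sqrt (\<tau>\<^sup>2 - b\<^sup>2) * (1 - \<theta>))\<^sup>2 = (\<tau>\<^sup>2 - b\<^sup>2) * (1 - \<theta>)\<^sup>2"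
      using sq by (simp add: power_mult_distrib)
    also have "\<dots> = ((\<tau> - b) - \<theta> * (\<tau> - b)) * ((\<tau> + b) * (1 - \<theta>))"
      by (simp add: power2_eq_square algebra_simps)
    also have "\<dots> \<le> ((\<tau> - b) - \<theta> * (\<tau> - b)) * (\<tau> + b + \<epsilon>)"
    proof (rule mult_left_mono)
      have "(\<tau> + b) * (1 - \<theta>) \<le> (\<tau> + b) * 1" using th assms by (intro mult_left_mono) auto
      then show "(\<tau> + b) * (1 - \<theta>) \<le> \<tau> + b + \<epsilon>" using eps by simp
    qed (use th eps in auto)
    also have "\<dots> = \<tau>\<^sup>2 - (b + \<epsilon>)\<^sup>2" unfolding th(3) by (simp add: power2_eq_square algebra_simps)
    finally show "(sqrt (\<tau>\<^sup>2 - b\<^sup>2) * (1 - \<theta>))\<^sup>2 \<le> \<tau>\<^sup>2 - (b + \<epsilon>)\<^sup>2" .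
  qed
  moreover have "L' * \<epsilon> = L * \<epsilon> + \<tau> * \<theta>" by (simp add: L'_def \<theta>_def algebra_simps)
  ultimately show ?thesis using that[OF eps] first by (simp add: algebra_simps)
qed

text \<open>
Concavity of \<open>y \<mapsto> sqrt (\<tau>\<^sup>2 - y\<^sup>2)\<close>, in the form needed for submodularity: the pair
\<open>m, m'\<close> has the same sum as \<open>p, q\<close> and lies between them.
\<close>

lemma sqrt_exchange:
  fixes \<tau> p q m m' :: real
  assumes "\<bar>p\<bar> \<le> \<tau>" "\<bar>q\<bar> \<le> \<tau>" "p \<le> m" "m \<le> q" "m + m' = p + q"
  shows "sqrt (\<tau>\<^sup>2 - p\<^sup>2) + sqrt (\<tau>\<^sup>2 - q\<^sup>2) \<le> sqrt (\<tau>\<^sup>2 - m\<^sup>2) + sqrt (\<tau>\<^sup>2 - m'\<^sup>2)"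
proof (cases "p = q")
  case True
  then show ?thesis using assms by auto
next
  case False
  define S where "S y = sqrt (\<tau>\<^sup>2 - y\<^sup>2)" for y
  define t where "t = (m - p) / (q - p)"
  have tq: "t * (q - p) = m - p" using False by (simp add: t_def)
  have t: "0 \<le> t" "t \<le> 1" using False assms by (auto simp: t_def divide_le_eq)
  have m: "m = (1 - t) * p + t * q" "m' = t * p + (1 - t) * q"
    using tq assms(5) by (simp_all add: algebra_simps)
  have Sq: "(S p)\<^sup>2 = \<tau>\<^sup>2 - p\<^sup>2" "(S q)\<^sup>2 = \<tau>\<^sup>2 - q\<^sup>2"
    using assms by (auto simp: S_def abs_le_square_iff[symmetric])
  have conc: "(1 - s) * S p + s * S q \<le> S ((1 - s) * p + s * q)" if s: "0 \<le> s" "s \<le> 1" for s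
    unfolding S_def[of "(1 - s) * p + s * q"]
  proof (rule real_le_rsqrt)
    have "0 \<le> (S p - S q)\<^sup>2 + (p - q)\<^sup>2" by simp
    also have "\<dots> = 2 * (\<tau>\<^sup>2 - S p * S q - p * q)" using Sq by (simp add: power2_diff)
    finally have "0 \<le> \<tau>\<^sup>2 - S p * S q - p * q" by simp
    then have "0 \<le> 2 * ((1 - s) * s) * (\<tau>\<^sup>2 - S p * S q - p * q)"
      using s by (intro mult_nonneg_nonneg) auto
    also have "\<dots> = \<tau>\<^sup>2 - ((1 - s) * p + s * q)\<^sup>2 - ((1 - s)\<^sup>2 * (\<tau>\<^sup>2 - p\<^sup>2) + 2 * ((1 - s) * s) * (S p * S q) + s\<^sup>2 * (\<tau>\<^sup>2 - q\<^sup>2))"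
      by (simp add: power2_eq_square algebra_simps)
    also have "(1 - s)\<^sup>2 * (\<tau>\<^sup>2 - p\<^sup>2) + 2 * ((1 - s) * s) * (S p * S q) + s\<^sup>2 * (\<tau>\<^sup>2 - q\<^sup>2) = ((1 - s) * S p + s * S q)\<^sup>2"
      unfolding Sq[symmetric] by (simp add: power2_eq_square algebra_simps)
    finally show "((1 - s) * S p + s * S q)\<^sup>2 \<le> \<tau>\<^sup>2 - ((1 - s) * p + s * q)\<^sup>2" by simp
  qed
  have "(1 - t) * S p + t * S q \<le> S m" using conc[of t] t m(1) by simp
  moreover have "t * S p + (1 - t) * S q \<le> S m'" using conc[of "1 - t"] t m(2) by simp
  ultimately show ?thesis unfolding S_def[symmetric] by (simp add: algebra_simps)
qed

context periodic_action
begin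

text \<open>
The momentum of a step of length \<open>y\<close>, inverse to \<open>p \<mapsto> \<tau> * vel p\<close>.
\<close>

definition mom :: "real \<Rightarrow> real" where
  "mom y = y / sqrt (\<tau>\<^sup>2 - y\<^sup>2)"

lemma sqrt_step_deriv:
  assumes "\<bar>y\<bar> < \<tau>"
  shows "((\<lambda>z. sqrt (\<tau>\<^sup>2 - z\<^sup>2)) has_real_derivative - mom y) (at y)"
proof -
  have "\<tau>\<^sup>2 - y\<^sup>2 > 0" using assms tau_pos power_strict_mono[of "\<bar>y\<bar>" \<tau> 2] by simp
  then show ?thesis unfolding mom_def
    by (auto intro!: derivative_eq_intros simp: field_simps)
qed

lemma vel_mom:
  assumes "\<bar>y\<bar> < \<tau>"
  shows "\<tau> * vel (mom y) = y"
proof -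
  have pos: "\<tau>\<^sup>2 - y\<^sup>2 > 0" using assms tau_pos power_strict_mono[of "\<bar>y\<bar>" \<tau> 2] by simp
  then have "1 + (mom y)\<^sup>2 = \<tau>\<^sup>2 / (\<tau>\<^sup>2 - y\<^sup>2)"
    by (simp add: mom_def power_divide field_simps)
  then have "sqrt (1 + (mom y)\<^sup>2) = \<tau> / sqrt (\<tau>\<^sup>2 - y\<^sup>2)"
    using tau_pos by (simp add: real_sqrt_divide)
  then show ?thesis using tau_pos pos by (simp add: vel_def) (simp add: mom_def)
qed

lemma mom_mono:
  assumes "\<bar>y\<bar> < \<tau>" "\<bar>z\<bar> < \<tau>"
  shows "mom y \<le> mom z \<longleftrightarrow> y \<le> z"
  using vel_mom[OF assms(1)] vel_mom[OF assms(2)] tau_pos strict_mono_less_eq[OF vel_strict_mono]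
  by (metis mult_le_cancel_left_pos)

text \<open>
Otherwise moving the site \<open>j\<close> slightly would lower the action by \<open>sqrt_gain\<close>. The sign \<open>s\<close>
treats both directions of motion at once.
\<close>

lemma minimal_saturated_step:
  assumes x: "minimal x" and s: "s = 1 \<or> s = (-1::real)" and step: "x j - x (j - 1) = s * \<tau>"
  shows "x (j + 1) - x j = s * \<tau>"
proof (rule ccontr)
  assume neq: "x (j + 1) - x j \<noteq> s * \<tau>"
  have xc: "x \<in> config" using x by (simp add: minimal_def)
  define b where "b = s * (x (j + 1) - x j)"
  have b: "\<bar>b\<bar> \<le> \<tau>" "b < \<tau>" "x (j + 1) - x j = s * b"
    using configD(2)[OF xc, of j] s neq by (auto simp: b_def abs_le_iff)
  have "A \<ge> 0" using g_bound[of 0] by linarith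
  then obtain \<epsilon> where e: "\<epsilon> > 0" "\<epsilon> \<le> \<tau>" "b + \<epsilon> \<le> \<tau>"
    and gain: "sqrt (\<tau>\<^sup>2 - b\<^sup>2) + (\<bar>F (j - 1)\<bar> + \<bar>F j\<bar> + \<tau> * A) * \<epsilon>
      < sqrt (\<tau>\<^sup>2 - (\<tau> - \<epsilon>)\<^sup>2) + sqrt (\<tau>\<^sup>2 - (b + \<epsilon>)\<^sup>2)"
    using sqrt_gain[OF tau_pos b(1,2), of "\<bar>F (j - 1)\<bar> + \<bar>F j\<bar> + \<tau> * A"] tau_pos by auto
  define y where "y = x j - s * \<epsilon>"
  have y: "y - x (j - 1) = s * (\<tau> - \<epsilon>)" "x (j + 1) - y = s * (b + \<epsilon>)"
    using step b(3) by (simp_all add: y_def algebra_simps)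
  have sabs: "\<bar>s * z\<bar> = \<bar>z\<bar>" and ssq: "(s * z)\<^sup>2 = z\<^sup>2" for z using s by (auto simp: power_mult_distrib)
  have "\<bar>y - x (j - 1)\<bar> \<le> \<tau>" "\<bar>x (j + 1) - y\<bar> \<le> \<tau>"
    unfolding y sabs using e b by (auto simp: abs_le_iff)
  from minimal_site[OF x this]
  have "sqrt (\<tau>\<^sup>2 - (\<tau> - \<epsilon>)\<^sup>2) + sqrt (\<tau>\<^sup>2 - (b + \<epsilon>)\<^sup>2)
    \<le> sqrt (\<tau>\<^sup>2 - b\<^sup>2) + (\<tau> * (G y - G (x j)) + F (j - 1) * (s * \<epsilon>) - F j * (s * \<epsilon>))"
    unfolding bond_def y step b(3) ssq by (simp add: algebra_simps)
  moreover have "\<tau> * (G y - G (x j)) \<le> \<tau> * A * \<epsilon>"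
    using DERIV_bound_imp_Lipschitz[OF G_deriv g_bound, of y "x j"] tau_pos e
    by (simp add: y_def sabs mult.assoc)
  moreover have "F (j - 1) * (s * \<epsilon>) \<le> \<bar>F (j - 1)\<bar> * \<epsilon>" "- (F j * (s * \<epsilon>)) \<le> \<bar>F j\<bar> * \<epsilon>"
    using abs_ge_self[of "F (j - 1) * (s * \<epsilon>)"] abs_ge_minus_self[of "F j * (s * \<epsilon>)"] e
    by (simp_all add: abs_mult[of "F _"] sabs)
  ultimately show False using gain by (simp add: algebra_simps)
qed

text \<open>
One step at the speed limit forces all later ones to be so, and then \<open>\<bar>r\<bar> = M * \<tau>\<close>.
\<close>

lemma minimal_interior:
  assumes x: "minimal x"
  shows "\<bar>x (j + 1) - x j\<bar> < \<tau>"
proof (rule ccontr)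
  have xc: "x \<in> config" using x by (simp add: minimal_def)
  assume "\<not> \<bar>x (j + 1) - x j\<bar> < \<tau>"
  then have "\<bar>x (j + 1) - x j\<bar> = \<tau>" using configD(2)[OF xc, of j] by simp
  then have "x (j + 1) - x j = 1 * \<tau> \<or> x (j + 1) - x j = -1 * \<tau>" by linarith
  then obtain s where s: "s = 1 \<or> s = (-1::real)" "x (j + 1) - x j = s * \<tau>" by blast
  have step: "x (j + int n + 1) - x (j + int n) = s * \<tau>" for n
  proof (induction n)
    case (Suc n)
    then show ?case using minimal_saturated_step[OF x s(1), of "j + int n + 1"] by (simp add: ac_simps)
  qed (use s in simp)
  have "x (j + int n) = x j + real n * (s * \<tau>)" for n
  proof (induction n)
    case (Suc n)
    then show ?case using step[of n] by (simp add: algebra_simps)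
  qed simp
  from this[of "nat M"] have "of_int r = of_int M * (s * \<tau>)"
    using configD(1)[OF xc, of j] M_ge_2 by simp
  then have "\<bar>of_int r\<bar> = of_int M * \<tau>" using s tau_pos M_ge_2 by (auto simp: abs_mult)
  then show False using slow by simp
qed

text \<open>
The bonds next to the site \<open>j\<close> are differentiable in its position, since the steps are interior.
\<close>

lemma euler_lagrange:
  assumes x: "minimal x"
  shows "mom (x (j + 1) - x j) - mom (x j - x (j - 1)) = \<tau> * g (x j) + F j - F (j - 1)"
proof -
  define \<psi> where "\<psi> y = bond (j - 1) (x (j - 1)) y + bond j y (x (j + 1))" for y
  define a where "a = x j - x (j - 1)"
  define b where "b = x (j + 1) - x j"
  have ab: "\<bar>a\<bar> < \<tau>" "\<bar>b\<bar> < \<tau>"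
    using minimal_interior[OF x, of "j - 1"] minimal_interior[OF x, of j] by (simp_all add: a_def b_def)
  define d where "d = min (\<tau> - \<bar>a\<bar>) (\<tau> - \<bar>b\<bar>)"
  have min: "\<psi> (x j) \<le> \<psi> y" if "\<bar>x j - y\<bar> < d" for y
    unfolding \<psi>_def using that by (intro minimal_site[OF x]) (auto simp: d_def a_def b_def)
  have "((\<lambda>z. sqrt (\<tau>\<^sup>2 - z\<^sup>2)) has_real_derivative - mom a) (at ((\<lambda>y. y - x (j - 1)) (x j)))"
    using sqrt_step_deriv[OF ab(1)] by (simp add: a_def)
  moreover have "((\<lambda>y. y - x (j - 1)) has_real_derivative 1) (at (x j))"
    by (auto intro!: derivative_eq_intros)
  ultimately
  have da: "((\<lambda>y. sqrt (\<tau>\<^sup>2 - (y - x (j - 1))\<^sup>2)) has_real_derivative - mom a * 1) (at (x j))"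
    by (rule DERIV_chain2)
  have "((\<lambda>z. sqrt (\<tau>\<^sup>2 - z\<^sup>2)) has_real_derivative - mom b) (at ((\<lambda>y. x (j + 1) - y) (x j)))"
    using sqrt_step_deriv[OF ab(2)] by (simp add: b_def)
  moreover have "((\<lambda>y. x (j + 1) - y) has_real_derivative -1) (at (x j))"
    by (auto intro!: derivative_eq_intros)
  ultimately
  have db: "((\<lambda>y. sqrt (\<tau>\<^sup>2 - (x (j + 1) - y)\<^sup>2)) has_real_derivative - mom b * -1) (at (x j))"
    by (rule DERIV_chain2)
  define sa where "sa y = sqrt (\<tau>\<^sup>2 - (y - x (j - 1))\<^sup>2)" for y
  define sb where "sb y = sqrt (\<tau>\<^sup>2 - (x (j + 1) - y)\<^sup>2)" for y
  have "\<psi> = (\<lambda>y. \<tau> * G (x (j - 1)) - sa y - F (j - 1) * (y - x (j - 1))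
      + (\<tau> * G y - sb y - F j * (x (j + 1) - y)))"
    by (simp add: fun_eq_iff \<psi>_def bond_def sa_def sb_def)
  then have "(\<psi> has_real_derivative (mom a - F (j - 1) + (\<tau> * g (x j) - mom b + F j))) (at (x j))"
    using da[folded sa_def] db[folded sb_def] by (auto intro!: derivative_eq_intros G_deriv)
  moreover have "d > 0" using ab by (simp add: d_def)
  ultimately have "mom a - F (j - 1) + (\<tau> * g (x j) - mom b + F j) = 0"
    using min by (intro DERIV_local_min[of \<psi> _ "x j" d]) auto
  then show ?thesis by (simp add: a_def b_def)
qed

end

section \<open>Order and momentum bounds for minimisers\<close>

context periodic_action
begin

text \<open>
Uncrossing two bonds does not increase the action; this is the discrete twist condition.
\<close>

lemma bond_exchange:
  assumes "\<bar>b - a\<bar> \<le> \<tau>" "\<bar>b' - a'\<bar> \<le> \<tau>" "a \<le> a'" "b' \<le> b"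
  shows "bond i a b' + bond i a' b \<le> bond i a b + bond i a' b'"
  using sqrt_exchange[of "b' - a'" \<tau> "b - a" "b' - a" "b - a'"] assms
  by (simp add: bond_def algebra_simps)

lemma bond_submodular:
  assumes "\<bar>b - a\<bar> \<le> \<tau>" "\<bar>b' - a'\<bar> \<le> \<tau>"
  shows "bond i (min a a') (min b b') + bond i (max a a') (max b b') \<le> bond i a b + bond i a' b'"
  using bond_exchange[OF assms, of i] bond_exchange[OF assms(2,1), of i]
  by (cases "a \<le> a'"; cases "b \<le> b'") (auto simp: min_def max_def)

text \<open>
By submodularity the minimum and the maximum together have at most the action of \<open>x\<close> and \<open>y\<close>, and the
maximum alone has at least that of \<open>y\<close>.
\<close>

lemma minimal_min:
  assumes x: "minimal x" and y: "minimal y"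
  shows "minimal (\<lambda>i. min (x i) (y i))"
proof -
  have c: "x \<in> config" "y \<in> config" using x y by (auto simp: minimal_def)
  let ?z = "\<lambda>i. min (x i) (y i)" and ?w = "\<lambda>i. max (x i) (y i)"
  have "\<bar>?z (i + 1) - ?z i\<bar> \<le> \<tau>" "\<bar>?w (i + 1) - ?w i\<bar> \<le> \<tau>" for i
    using configD(2)[OF c(1), of i] configD(2)[OF c(2), of i] by (auto simp: min_def max_def abs_le_iff)
  then have zw: "?z \<in> config" "?w \<in> config"
    unfolding config_def using configD(1)[OF c(1)] configD(1)[OF c(2)] by auto
  have "action ?z + action ?w \<le> action x + action y"
    unfolding action_def sum.distrib[symmetric]
    using configD(2)[OF c(1)] configD(2)[OF c(2)] by (intro sum_mono bond_submodular)
  moreover have "action y \<le> action ?w" using y zw by (simp add: minimal_def)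
  ultimately show ?thesis using x zw(1) unfolding minimal_def by (auto intro: order_trans[rotated])
qed

text \<open>
At a touching point the two Euler--Lagrange equations have equal right-hand sides, while
\<open>z \<le> x\<close> orders the outgoing momenta one way and the incoming ones the other way. Hence the
neighbouring sites agree as well.
\<close>

lemma minimal_touching:
  assumes z: "minimal z" and x: "minimal x" and le: "\<And>i. z i \<le> x i" and touch: "z i = x i"
  shows "z j = x j"
proof -
  have step: "z (i + 1) = x (i + 1) \<and> z (i - 1) = x (i - 1)" if eq: "z i = x i" for i
  proof -
    have int: "\<bar>z (i + 1) - z i\<bar> < \<tau>" "\<bar>x (i + 1) - x i\<bar> < \<tau>" "\<bar>z i - z (i - 1)\<bar> < \<tau>" "\<bar>x i - x (i - 1)\<bar> < \<tau>"
      using minimal_interior[OF z, of i] minimal_interior[OF x, of i]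
        minimal_interior[OF z, of "i - 1"] minimal_interior[OF x, of "i - 1"] by simp_all
    have "mom (z (i + 1) - z i) - mom (z i - z (i - 1)) = mom (x (i + 1) - x i) - mom (x i - x (i - 1))"
      using euler_lagrange[OF z, of i] euler_lagrange[OF x, of i] eq by simp
    moreover have "mom (z (i + 1) - z i) \<le> mom (x (i + 1) - x i)"
      using mom_mono[OF int(1,2)] le[of "i + 1"] eq by simp
    moreover have "mom (x i - x (i - 1)) \<le> mom (z i - z (i - 1))"
      using mom_mono[OF int(4,3)] le[of "i - 1"] eq by simp
    ultimately have "mom (x (i + 1) - x i) \<le> mom (z (i + 1) - z i)" "mom (z i - z (i - 1)) \<le> mom (x i - x (i - 1))"
      by linarith+
    then show ?thesis
      using mom_mono[OF int(2,1)] mom_mono[OF int(3,4)] le[of "i + 1"] le[of "i - 1"] eq by auto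
  qed
  show ?thesis
    by (induction j rule: int_induct[of _ i]) (use touch step in auto)
qed

lemma minimal_comparable:
  assumes x: "minimal x" and y: "minimal y"
  shows "(\<forall>i. x i \<le> y i) \<or> (\<forall>i. y i \<le> x i)"
proof (cases "\<exists>i. x i \<le> y i")
  case True
  then obtain i where "min (x i) (y i) = x i" by (meson min.absorb1)
  then have "min (x j) (y j) = x j" for j
    using minimal_touching[OF minimal_min[OF x y] x, of i j] by simp
  then show ?thesis by (metis min.absorb_iff1)
next
  case False
  then show ?thesis by (meson less_imp_le not_le)
qed

text \<open>
The translate by \<open>(a, b)\<close> is again a minimiser and thus comparable with \<open>x\<close>. If it were
below \<open>x\<close>, then so would be its \<open>s\<close>-fold iterate, which is \<open>x\<close> shifted by the positive number
\<open>a * r + b * s\<close>.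
\<close>

lemma minimal_order:
  assumes x: "minimal x" and M: "M = s * N" "s > 0" and F: "\<And>i. F (i + N) = F i"
    and pos: "a * r + b * s > 0"
  shows "x i \<le> x (i + a * N) + of_int b"
proof (rule ccontr)
  assume neg: "\<not> x i \<le> x (i + a * N) + of_int b"
  have xc: "x \<in> config" using x by (simp add: minimal_def)
  have "F (i + a * N) = F i" for i using int_quasiperiodic[of F N 0 i a] F by simp
  from minimal_comparable[OF x minimal_translate[OF x this, of b]] neg
  have le: "x (i + a * N) + of_int b \<le> x i" for i by blast
  have "x (i + int n * (a * N)) + of_int (int n) * of_int b \<le> x i" for n i
  proof (induction n)
    case (Suc n)
    then show ?case using le[of "i + int n * (a * N)"] by (simp add: algebra_simps)
  qed simp
  from this[of 0 "nat s"] have "x (0 + a * M) + of_int s * of_int b \<le> x 0"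
    using M by (simp add: ac_simps)
  then have "of_int (a * r + b * s) \<le> (0 :: real)" 
    unfolding configD(3)[OF xc] by (simp add: ac_simps)
  then show False using pos by linarith
qed

text \<open>
The order relation is applied to \<open>(- k, b)\<close> and \<open>(k, b')\<close>, with \<open>b\<close> and \<open>b'\<close> the least integers
strictly above \<open>k * r / s\<close> and \<open>- k * r / s\<close>.
\<close>

lemma minimal_mean_speed:
  assumes x: "minimal x" and M: "M = s * N" "s > 0" and F: "\<And>i. F (i + N) = F i"
  shows "\<bar>x (i + k * N) - x i - of_int k * (of_int r / of_int s)\<bar> \<le> 1"
proof -
  define v where "v = of_int k * (of_int r / real_of_int s)"
  have vs: "v * of_int s = of_int k * of_int r" using M by (simp add: v_def)
  define b where "b = \<lfloor>v\<rfloor> + 1"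
  define b' where "b' = \<lfloor>-v\<rfloor> + 1"
  have b: "v < of_int b" "of_int b \<le> v + 1" and b': "-v < of_int b'" "of_int b' \<le> -v + 1"
    unfolding b_def b'_def by linarith+
  have s: "real_of_int s > 0" using M(2) by simp
  have "v * of_int s < of_int b * of_int s" "- v * of_int s < of_int b' * of_int s"
    by (rule mult_strict_right_mono[OF b(1) s], rule mult_strict_right_mono[OF b'(1) s])
  then have "0 < - (v * of_int s) + of_int b * of_int s" "0 < v * of_int s + of_int b' * of_int s"
    by linarith+
  then have "0 < real_of_int ((-k) * r + b * s)" "0 < real_of_int (k * r + b' * s)"
    unfolding vs by simp_all
  then have "(-k) * r + b * s > 0" "k * r + b' * s > 0" unfolding of_int_0_less_iff .
  from minimal_order[OF x M F this(1), of "i + k * N"] minimal_order[OF x M F this(2), of i]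
  show ?thesis using b b' unfolding v_def[symmetric] by (simp add: abs_le_iff)
qed

text \<open>
If the average speed over a window is below \<open>c\<close>, then some step in it has velocity below \<open>c\<close>
and some step has velocity above \<open>- c\<close>. The Euler--Lagrange equation limits the change of
momentum from \<open>i\<close> to these steps.
\<close>

lemma minimal_momentum_bound:
  assumes x: "minimal x" and c: "0 \<le> c" "c < 1" and w: "w > 0"
    and slow_window: "\<bar>x (i + w) - x i\<bar> < of_int w * (c * \<tau>)"
    and F: "\<And>i. \<bar>F i - F (i - 1)\<bar> \<le> \<tau> * A'"
  shows "\<bar>mom (x (i + 1) - x i)\<bar> \<le> c / sqrt (1 - c\<^sup>2) + of_int w * (\<tau> * (A + A'))"
proof -
  define P where "P i = mom (x (i + 1) - x i)" for i
  have step: "\<bar>P (j + 1) - P j - 0\<bar> \<le> \<tau> * (A + A')" for j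
  proof -
    have "\<bar>\<tau> * g (x (j + 1))\<bar> \<le> \<tau> * A" using g_bound tau_pos by (simp add: abs_mult)
    moreover have "P (j + 1) - P j = \<tau> * g (x (j + 1)) + (F (j + 1) - F (j + 1 - 1))"
      using euler_lagrange[OF x, of "j + 1"] by (simp add: P_def)
    ultimately show ?thesis using F[of "j + 1"] unfolding distrib_left by linarith
  qed
  have "\<tau> * (A + A') \<ge> 0" using step[of 0] by linarith
  then have near: "\<bar>P j - P i\<bar> \<le> of_int w * (\<tau> * (A + A'))" if "i \<le> j" "j < i + w" for j
    using int_increment_bound[OF that(1), of P 0, OF step] that
      mult_right_mono[of "of_int (j - i)" "of_int w" "\<tau> * (A + A')"] by simp
  have "c\<^sup>2 < 1" using c by (simp add: abs_square_less_1)
  have ct: "\<bar>c * \<tau>\<bar> < \<tau>" using c tau_pos by (simp add: abs_mult)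
  have "\<tau>\<^sup>2 - (c * \<tau>)\<^sup>2 = \<tau>\<^sup>2 * (1 - c\<^sup>2)" by (simp add: power_mult_distrib algebra_simps)
  then have momc: "mom (c * \<tau>) = c / sqrt (1 - c\<^sup>2)"
    using tau_pos by (simp add: mom_def real_sqrt_mult)
  have mom_minus: "mom (- y) = - mom y" for y by (simp add: mom_def)
  obtain j where j: "i \<le> j" "j < i + w" "x (j + 1) - x j < c * \<tau>"
    using exists_increment_below[of x i w "c * \<tau>"] slow_window w unfolding abs_less_iff by blast
  then have "P j \<le> mom (c * \<tau>)"
    unfolding P_def using mom_mono[OF minimal_interior[OF x] ct] by simp
  moreover obtain k where k: "i \<le> k" "k < i + w" "- x (k + 1) - - x k < c * \<tau>"
    using exists_increment_below[of "\<lambda>i. - x i" i w "c * \<tau>"] slow_window w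
    unfolding abs_less_iff minus_diff_minus minus_diff_eq by blast
  then have "mom (- (c * \<tau>)) \<le> P k"
    unfolding P_def using ct by (subst mom_mono[OF _ minimal_interior[OF x]]) auto
  ultimately show ?thesis
    using near[OF j(1,2)] near[OF k(1,2)] unfolding P_def[symmetric] momc mom_minus by linarith
qed

end

section \<open>Passing from minimisers to trajectories\<close>

locale forced_system =
  fixes T :: real and g f G F :: "real \<Rightarrow> real" and A A' K :: real
  assumes T_pos: "T > 0"
    and G_deriv: "(G has_real_derivative g a) (at a)"
    and G_periodic: "G (a + 1) = G a"
    and g_periodic: "g (a + 1) = g a"
    and g_bound: "\<bar>g a\<bar> \<le> A"
    and g_Lipschitz: "\<bar>g a - g b\<bar> \<le> K * \<bar>a - b\<bar>"
    and F_deriv: "(F has_real_derivative f t) (at t)"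
    and F_periodic: "F (t + T) = F t"
    and f_bound: "\<bar>f t\<bar> \<le> A'"
begin

lemma bounds_nonneg: "A \<ge> 0" "A' \<ge> 0" "K \<ge> 0"
  using g_bound[of 0] f_bound[of 0] order_trans[OF abs_ge_zero g_Lipschitz[of 1 0]] by simp_all

lemma F_Lipschitz: "\<bar>F t - F t'\<bar> \<le> A' * \<bar>t - t'\<bar>"
  by (rule DERIV_bound_imp_Lipschitz[OF F_deriv f_bound])

text \<open>
For \<open>\<eta> = 0\<close> the conditions imply that \<open>(q, p)\<close> solves the system, and they also bound the
momentum by \<open>L\<close>. Step functions that interpolate discrete orbits of step size \<open>\<eta>\<close> satisfy
the version with error terms.
\<close>

definition approx_trajectory ::
  "real \<Rightarrow> real \<Rightarrow> (real \<Rightarrow> real) \<Rightarrow> (real \<Rightarrow> real) \<Rightarrow> bool" where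
  "approx_trajectory L \<eta> q p \<longleftrightarrow> (\<forall>t t'.
     \<bar>q t' - q t - (t' - t) * vel (p t)\<bar> \<le> L * ((\<bar>t' - t\<bar> + 2 * \<eta>)\<^sup>2 + \<eta>) \<and>
     \<bar>p t' - p t - (t' - t) * g (q t) - (F t' - F t)\<bar> \<le> L * ((\<bar>t' - t\<bar> + 2 * \<eta>)\<^sup>2 + \<eta>) \<and>
     \<bar>p t\<bar> \<le> L)"

text \<open>
Every condition is a closed inequality between finitely many values of \<open>q\<close> and \<open>p\<close>.
\<close>

lemma approx_trajectory_limit:
  assumes "F' \<noteq> bot" and \<eta>: "(\<eta> \<longlongrightarrow> 0) F'"
    and q: "\<And>t. ((\<lambda>i. Q i t) \<longlongrightarrow> q t) F'" and p: "\<And>t. ((\<lambda>i. P i t) \<longlongrightarrow> p t) F'"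
    and ev: "\<forall>\<^sub>F i in F'. approx_trajectory L (\<eta> i) (Q i) (P i)"
  shows "approx_trajectory L 0 q p"
  unfolding approx_trajectory_def
proof (intro allI conjI)
  fix t t'
  have g: "((\<lambda>i. g (Q i t)) \<longlongrightarrow> g (q t)) F'"
  proof -
    have "continuous_on UNIV g"
      using g_Lipschitz bounds_nonneg
      by (intro lipschitz_on_continuous_on[of K] lipschitz_onI) (auto simp: dist_real_def)
    then show ?thesis using q[of t] by (auto intro: continuous_on_tendsto_compose[where f = g and s = UNIV])
  qed
  have v: "((\<lambda>i. vel (P i t)) \<longlongrightarrow> vel (p t)) F'"
    using DERIV_isCont[OF vel_deriv] p[of t] by (rule isCont_tendsto_compose)
  have err: "((\<lambda>i. L * ((\<bar>t' - t\<bar> + 2 * \<eta> i)\<^sup>2 + \<eta> i)) \<longlongrightarrow> L * ((\<bar>t' - t\<bar> + 2 * 0)\<^sup>2 + 0)) F'"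
    by (intro tendsto_intros \<eta>)
  have "((\<lambda>i. \<bar>Q i t' - Q i t - (t' - t) * vel (P i t)\<bar>) \<longlongrightarrow> \<bar>q t' - q t - (t' - t) * vel (p t)\<bar>) F'"
    by (intro tendsto_intros q v)
  then show "\<bar>q t' - q t - (t' - t) * vel (p t)\<bar> \<le> L * ((\<bar>t' - t\<bar> + 2 * 0)\<^sup>2 + 0)"
    by (rule tendsto_le[OF \<open>F' \<noteq> bot\<close> err])
      (use ev in \<open>eventually_elim, auto simp: approx_trajectory_def\<close>)
  have "((\<lambda>i. \<bar>P i t' - P i t - (t' - t) * g (Q i t) - (F t' - F t)\<bar>) \<longlongrightarrow>
      \<bar>p t' - p t - (t' - t) * g (q t) - (F t' - F t)\<bar>) F'"
    by (intro tendsto_intros p g)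
  then show "\<bar>p t' - p t - (t' - t) * g (q t) - (F t' - F t)\<bar> \<le> L * ((\<bar>t' - t\<bar> + 2 * 0)\<^sup>2 + 0)"
    by (rule tendsto_le[OF \<open>F' \<noteq> bot\<close> err])
      (use ev in \<open>eventually_elim, auto simp: approx_trajectory_def\<close>)
  show "\<bar>p t\<bar> \<le> L"
    by (rule tendsto_upperbound[OF tendsto_rabs[OF p[of t]] _ \<open>F' \<noteq> bot\<close>])
      (use ev in \<open>eventually_elim, auto simp: approx_trajectory_def\<close>)
qed

text \<open>
The hypothesis \<open>window\<close> says that a displacement of \<open>k\<close> times the rotation number, plus the
error \<open>1\<close> from \<open>minimal_mean_speed\<close>, keeps the average speed over \<open>k\<close> periods below \<open>c\<close>. The
resulting momentum bound depends only on \<open>c\<close> and \<open>k\<close>.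
\<close>

lemma discrete_orbit:
  fixes N s r :: int and k :: nat and c \<tau> :: real
  assumes N: "N \<ge> 2" and s: "s > 0" and c: "0 \<le> c" "c < 1" and k: "k > 0"
    and window: "real k * \<bar>of_int r / of_int s\<bar> + 1 < c * real k * T"
  defines "\<tau> \<equiv> T / of_int N"
  obtains x P where
    "\<And>i. x (i + 1) - x i = \<tau> * vel (P i)"
    "\<And>i. P (i + 1) - P i = \<tau> * g (x (i + 1)) + F (of_int (i + 1) * \<tau>) - F (of_int i * \<tau>)"
    "\<And>i. \<bar>P i\<bar> \<le> c / sqrt (1 - c\<^sup>2) + real k * T * (A + A')"
    "x 0 \<in> {0..1}"
    "\<And>a b i. a * r + b * s > 0 \<Longrightarrow> x i \<le> x (i + a * N) + of_int b"
proof -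
  have tau: "\<tau> > 0" "\<tau> * of_int N = T" using T_pos N by (auto simp: \<tau>_def)
  define \<phi> where "\<phi> i = F (of_int i * \<tau>)" for i
  have phi: "\<phi> (i + N) = \<phi> i" for i
    using F_periodic[of "of_int i * \<tau>"] tau(2) by (simp add: \<phi>_def algebra_simps)
  have "real k * \<bar>of_int r / of_int s\<bar> < real k * T"
  proof -
    have "c * real k * T \<le> 1 * (real k * T)" unfolding mult.assoc using c T_pos by (intro mult_right_mono) auto
    then show ?thesis using window by simp
  qed
  then have "\<bar>of_int r / of_int s\<bar> < T"
    using k by (simp only: mult_less_cancel_left_pos of_nat_0_less_iff)
  then have "\<bar>of_int r\<bar> < of_int s * T" using s by (simp add: abs_divide pos_divide_less_eq mult.commute)
  moreover have "2 * 1 \<le> N * s" using N s by (intro mult_mono) auto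
  ultimately interpret periodic_action \<tau> G g A \<phi> "s * N" r
    using tau G_deriv g_bound G_periodic int_quasiperiodic[of \<phi> N 0 _ s] phi
    by unfold_locales (auto simp: algebra_simps)
  obtain x where x: "minimal x" "x 0 \<in> {0..1}" by (rule minimal_exists)
  define P where "P i = mom (x (i + 1) - x i)" for i
  show ?thesis
  proof
    fix i
    show "x (i + 1) - x i = \<tau> * vel (P i)"
      unfolding P_def using vel_mom[OF minimal_interior[OF x(1), of i]] by simp
    show "P (i + 1) - P i = \<tau> * g (x (i + 1)) + F (of_int (i + 1) * \<tau>) - F (of_int i * \<tau>)"
      using euler_lagrange[OF x(1), of "i + 1"] by (simp add: P_def \<phi>_def)
    have "\<bar>x (i + int k * N) - x i\<bar> < of_int (int k * N) * (c * \<tau>)"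
    proof -
      define v where "v = of_int (int k) * (of_int r / real_of_int s)"
      have "\<bar>x (i + int k * N) - x i - v\<bar> \<le> 1"
        unfolding v_def by (rule minimal_mean_speed[OF x(1) refl s phi])
      then have "\<bar>x (i + int k * N) - x i\<bar> \<le> \<bar>v\<bar> + 1" by linarith
      also have "\<bar>v\<bar> = real k * \<bar>of_int r / of_int s\<bar>" by (simp add: v_def abs_mult)
      also note window
      also have "c * real k * T = of_int (int k * N) * (c * \<tau>)" using tau(2) by (simp add: ac_simps)
      finally show ?thesis .
    qed
    moreover have "\<bar>\<phi> j - \<phi> (j - 1)\<bar> \<le> \<tau> * A'" for j
      using F_Lipschitz[of "of_int j * \<tau>" "of_int (j - 1) * \<tau>"] tau(1)
      by (simp add: \<phi>_def algebra_simps)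
    moreover have "int k * N > 0" using k N by simp
    ultimately have "\<bar>P i\<bar> \<le> c / sqrt (1 - c\<^sup>2) + of_int (int k * N) * (\<tau> * (A + A'))"
      unfolding P_def using minimal_momentum_bound[OF x(1) c] by blast
    also have "of_int (int k * N) * (\<tau> * (A + A')) = real k * T * (A + A')"
      using tau(2) by (simp add: ac_simps)
    finally show "\<bar>P i\<bar> \<le> c / sqrt (1 - c\<^sup>2) + real k * T * (A + A')" .
  next
    show "x 0 \<in> {0..1}" by (rule x(2))
  next
    fix a b i assume "a * r + b * s > 0"
    then show "x i \<le> x (i + a * N) + of_int b"
      by (rule minimal_order[OF x(1) refl s phi])
  qed
qed

text \<open>
The step function \<open>t \<mapsto> x \<lfloor>t / \<tau>\<rfloor>\<close> inherits the order exactly, because \<open>T\<close> is a multiple of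
\<open>\<tau>\<close>. The error constant \<open>L\<close> does not depend on the step size.
\<close>

lemma approx_orbit:
  fixes N s r :: int and k :: nat and c \<tau> L :: real
  assumes N: "N \<ge> 2" and s: "s > 0" and c: "0 \<le> c" "c < 1" and k: "k > 0"
    and window: "real k * \<bar>of_int r / of_int s\<bar> + 1 < c * real k * T"
  defines "\<tau> \<equiv> T / of_int N"
    and "L \<equiv> 1 + K + A + 2 * A' + (c / sqrt (1 - c\<^sup>2) + real k * T * (A + A'))"
  obtains q p where "approx_trajectory L \<tau> q p" "\<And>t. \<bar>q t\<bar> \<le> 1 + T + \<bar>t\<bar>"
    "\<And>a b t. a * r + b * s > 0 \<Longrightarrow> q t \<le> q (t + of_int a * T) + of_int b"
proof -
  have tau: "\<tau> > 0" "\<tau> * of_int N = T" "\<tau> \<le> T" using T_pos N by (auto simp: \<tau>_def divide_le_eq)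
  obtain x P where step: "\<And>i. x (i + 1) - x i = \<tau> * vel (P i)"
    and mstep: "\<And>i. P (i + 1) - P i = \<tau> * g (x (i + 1)) + F (of_int (i + 1) * \<tau>) - F (of_int i * \<tau>)"
    and Pb: "\<And>i. \<bar>P i\<bar> \<le> c / sqrt (1 - c\<^sup>2) + real k * T * (A + A')"
    and x0: "x 0 \<in> {0..1}"
    and order: "\<And>a b i. a * r + b * s > 0 \<Longrightarrow> x i \<le> x (i + a * N) + of_int b"
    using discrete_orbit[OF N s c k window] unfolding \<tau>_def[symmetric] by blast
  have Bnn: "0 \<le> c / sqrt (1 - c\<^sup>2) + real k * T * (A + A')" using Pb[of 0] by linarith
  have L: "A + A' \<le> L" "1 \<le> L" "K \<le> L" "A + 2 * A' \<le> L"
    using Bnn bounds_nonneg unfolding L_def by linarith+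
  have "\<bar>P (i + 1) - P i - 0\<bar> \<le> \<tau> * (A + A')" for i
  proof -
    have "\<bar>\<tau> * g (x (i + 1))\<bar> \<le> \<tau> * A" using g_bound tau by (simp add: abs_mult)
    moreover have "\<bar>F (of_int (i + 1) * \<tau>) - F (of_int i * \<tau>)\<bar> \<le> \<tau> * A'"
      using F_Lipschitz[of "of_int (i + 1) * \<tau>" "of_int i * \<tau>"] tau by (simp add: algebra_simps)
    ultimately show ?thesis using mstep[of i] unfolding distrib_left by linarith
  qed
  then have P_diff: "\<bar>P j - P i\<bar> \<le> of_int \<bar>j - i\<bar> * (\<tau> * (A + A'))" for i j
    using int_increment_bound_sym[of i j P 0] by simp
  have "\<bar>x (i + 1) - x i - 0\<bar> \<le> \<tau>" for i
    unfolding step using vel_bound[of "P i"] tau by (simp add: abs_mult)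
  then have x_diff: "\<bar>x j - x i\<bar> \<le> of_int \<bar>j - i\<bar> * \<tau>" for i j
    using int_increment_bound_sym[of i j x 0] by simp
  have x_est: "\<bar>x j - x i - of_int (j - i) * (\<tau> * vel (P i))\<bar> \<le> (A + A') * (of_int \<bar>j - i\<bar> * \<tau>)\<^sup>2" for i j
  proof -
    have "\<bar>x (l + 1) - x l - \<tau> * vel (P i)\<bar> \<le> \<tau> * (of_int \<bar>j - i\<bar> * (\<tau> * (A + A')))"
      if "min i j \<le> l" "l < max i j" for l
    proof -
      have "\<bar>l - i\<bar> \<le> \<bar>j - i\<bar>" using that by linarith
      have "\<bar>x (l + 1) - x l - \<tau> * vel (P i)\<bar> = \<tau> * \<bar>vel (P l) - vel (P i)\<bar>"
        unfolding step using tau by (simp add: right_diff_distrib[symmetric] abs_mult)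
      also have "\<dots> \<le> \<tau> * \<bar>P l - P i\<bar>" using tau vel_Lipschitz by simp
      also have "\<dots> \<le> \<tau> * (of_int \<bar>l - i\<bar> * (\<tau> * (A + A')))" using tau P_diff by simp
      also have "\<dots> \<le> \<tau> * (of_int \<bar>j - i\<bar> * (\<tau> * (A + A')))"
        using tau bounds_nonneg \<open>\<bar>l - i\<bar> \<le> \<bar>j - i\<bar>\<close>
        by (intro mult_left_mono mult_right_mono) (auto simp: of_int_le_iff simp del: of_int_abs)
      finally show ?thesis .
    qed
    from int_increment_bound_sym[of i j x, OF this] show ?thesis
      by (simp add: power2_eq_square mult_ac)
  qed
  have P_est: "\<bar>P j - P i - (F (of_int j * \<tau>) - F (of_int i * \<tau>)) - of_int (j - i) * (\<tau> * g (x i))\<bar>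
      \<le> K * (of_int (\<bar>j - i\<bar> + 1) * \<tau>)\<^sup>2" for i j
  proof -
    define u where "u l = P l - F (of_int l * \<tau>)" for l
    have "\<bar>u (l + 1) - u l - \<tau> * g (x i)\<bar> \<le> \<tau> * (K * (of_int (\<bar>j - i\<bar> + 1) * \<tau>))"
      if "min i j \<le> l" "l < max i j" for l
    proof -
      have le: "\<bar>l + 1 - i\<bar> \<le> \<bar>j - i\<bar> + 1" using that by linarith
      have "\<bar>u (l + 1) - u l - \<tau> * g (x i)\<bar> = \<bar>\<tau> * (g (x (l + 1)) - g (x i))\<bar>"
        using mstep[of l] by (simp add: u_def right_diff_distrib)
      also have "\<dots> = \<tau> * \<bar>g (x (l + 1)) - g (x i)\<bar>" using tau by (simp add: abs_mult)
      also have "\<dots> \<le> \<tau> * (K * \<bar>x (l + 1) - x i\<bar>)" using tau g_Lipschitz by simp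
      also have "\<dots> \<le> \<tau> * (K * (of_int \<bar>l + 1 - i\<bar> * \<tau>))"
        using tau bounds_nonneg by (intro mult_left_mono x_diff) auto
      also have "\<dots> \<le> \<tau> * (K * (of_int (\<bar>j - i\<bar> + 1) * \<tau>))"
        using tau bounds_nonneg le
        by (intro mult_left_mono mult_right_mono) (auto simp: of_int_le_iff simp del: of_int_abs of_int_add)
      finally show ?thesis .
    qed
    from int_increment_bound_sym[of i j u, OF this]
    have "\<bar>u j - u i - of_int (j - i) * (\<tau> * g (x i))\<bar> \<le> of_int \<bar>j - i\<bar> * (\<tau> * (K * (of_int (\<bar>j - i\<bar> + 1) * \<tau>)))" .
    also have "\<dots> \<le> of_int (\<bar>j - i\<bar> + 1) * (\<tau> * (K * (of_int (\<bar>j - i\<bar> + 1) * \<tau>)))"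
      using tau bounds_nonneg by (intro mult_right_mono) auto
    finally show ?thesis by (simp add: u_def power2_eq_square algebra_simps)
  qed
  define fl where "fl t = \<lfloor>t / \<tau>\<rfloor>" for t
  have fl: "of_int (fl t) * \<tau> \<le> t" "t < of_int (fl t) * \<tau> + \<tau>" for t
  proof -
    show "of_int (fl t) * \<tau> \<le> t"
      using tau of_int_floor_le[of "t / \<tau>"] unfolding fl_def by (simp only: pos_le_divide_eq)
    have "t < (of_int (fl t) + 1) * \<tau>"
      using tau real_of_int_floor_add_one_gt[of "t / \<tau>"] unfolding fl_def by (simp only: pos_divide_less_eq)
    then show "t < of_int (fl t) * \<tau> + \<tau>" by (simp add: algebra_simps)
  qed
  define q where "q t = x (fl t)" for t
  define p where "p t = P (fl t)" for t
  show ?thesis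
  proof
    show "approx_trajectory L \<tau> q p" unfolding approx_trajectory_def
    proof (intro allI conjI)
      fix t t'
      let ?i = "fl t" and ?j = "fl t'"
      define d where "d = (\<bar>t' - t\<bar> + 2 * \<tau>)\<^sup>2"
      have ij: "\<bar>of_int (?j - ?i) * \<tau> - (t' - t)\<bar> \<le> \<tau>"
        using fl[of t] fl[of t'] by (simp add: left_diff_distrib abs_le_iff)
      have m: "of_int \<bar>?j - ?i\<bar> * \<tau> \<le> \<bar>t' - t\<bar> + \<tau>"
      proof -
        have "of_int \<bar>?j - ?i\<bar> * \<tau> = \<bar>of_int (?j - ?i) * \<tau>\<bar>" using tau by (simp add: abs_mult)
        then show ?thesis using ij by linarith
      qed
      have m1: "(of_int \<bar>?j - ?i\<bar> * \<tau>)\<^sup>2 \<le> d" unfolding d_def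
        using m tau by (intro power_mono) auto
      have m2: "(of_int (\<bar>?j - ?i\<bar> + 1) * \<tau>)\<^sup>2 \<le> d" unfolding d_def
        using m tau by (intro power_mono) (auto simp: distrib_right)
      have d: "d \<ge> 0" by (simp add: d_def)
      have diff: "\<bar>of_int (?j - ?i) * (\<tau> * w) - (t' - t) * w\<bar> \<le> \<tau> * W" if "\<bar>w\<bar> \<le> W" for w W
      proof -
        have "\<bar>of_int (?j - ?i) * (\<tau> * w) - (t' - t) * w\<bar> = \<bar>of_int (?j - ?i) * \<tau> - (t' - t)\<bar> * \<bar>w\<bar>"
          by (simp add: abs_mult[symmetric] left_diff_distrib mult.assoc)
        also have "\<dots> \<le> \<tau> * W" using ij that tau by (intro mult_mono) auto
        finally show ?thesis .
      qed
      have "\<bar>q t' - q t - (t' - t) * vel (p t)\<bar> \<le> (A + A') * d + \<tau> * 1"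
      proof -
        have "(A + A') * (of_int \<bar>?j - ?i\<bar> * \<tau>)\<^sup>2 \<le> (A + A') * d"
          using m1 bounds_nonneg by (intro mult_left_mono) auto
        then show ?thesis
          using x_est[of ?j ?i] diff[of "vel (P ?i)" 1] vel_bound[of "P ?i"] unfolding q_def p_def by linarith
      qed
      also have "\<dots> \<le> L * d + \<tau> * L"
        by (intro add_mono mult_left_mono mult_right_mono L d less_imp_le[OF tau(1)])
      finally show "\<bar>q t' - q t - (t' - t) * vel (p t)\<bar> \<le> L * ((\<bar>t' - t\<bar> + 2 * \<tau>)\<^sup>2 + \<tau>)"
        by (simp add: d_def algebra_simps)
      have near: "\<bar>F (of_int (fl t) * \<tau>) - F t\<bar> \<le> \<tau> * A'" for t
      proof -
        have "\<bar>F (of_int (fl t) * \<tau>) - F t\<bar> \<le> A' * \<bar>of_int (fl t) * \<tau> - t\<bar>" by (rule F_Lipschitz)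
        also have "\<dots> \<le> A' * \<tau>" using fl[of t] bounds_nonneg by (intro mult_left_mono) auto
        finally show ?thesis by (simp add: mult.commute)
      qed
      have "\<bar>p t' - p t - (t' - t) * g (q t) - (F t' - F t)\<bar> \<le> K * d + \<tau> * (A + 2 * A')"
      proof -
        \<comment> \<open>\<open>e1\<close> is the error of the discrete orbit, the others come from rounding times to
          multiples of \<open>\<tau>\<close>.\<close>
        define e1 where "e1 = P ?j - P ?i - (F (of_int ?j * \<tau>) - F (of_int ?i * \<tau>))
          - of_int (?j - ?i) * (\<tau> * g (x ?i))"
        define e2 where "e2 = of_int (?j - ?i) * (\<tau> * g (x ?i)) - (t' - t) * g (x ?i)"
        define e3 where "e3 = F (of_int ?j * \<tau>) - F t'"
        define e4 where "e4 = F (of_int ?i * \<tau>) - F t"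
        have "\<bar>e1\<bar> \<le> K * (of_int (\<bar>?j - ?i\<bar> + 1) * \<tau>)\<^sup>2" unfolding e1_def by (rule P_est)
        also have "\<dots> \<le> K * d" using m2 bounds_nonneg by (intro mult_left_mono) auto
        finally have "\<bar>e1\<bar> \<le> K * d" .
        moreover have "\<bar>e2\<bar> \<le> \<tau> * A" unfolding e2_def by (rule diff[OF g_bound])
        moreover have "\<bar>e3\<bar> \<le> \<tau> * A'" "\<bar>e4\<bar> \<le> \<tau> * A'" unfolding e3_def e4_def by (rule near)+
        ultimately have "\<bar>e1 + e2 + e3 - e4\<bar> \<le> K * d + (\<tau> * A + (\<tau> * A' + \<tau> * A'))" by linarith
        moreover have "p t' - p t - (t' - t) * g (q t) - (F t' - F t) = e1 + e2 + e3 - e4"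
          by (simp add: p_def q_def e1_def e2_def e3_def e4_def)
        ultimately show ?thesis by (simp add: algebra_simps)
      qed
      also have "\<dots> \<le> L * d + \<tau> * L"
        by (intro add_mono mult_left_mono mult_right_mono L d less_imp_le[OF tau(1)])
      finally show "\<bar>p t' - p t - (t' - t) * g (q t) - (F t' - F t)\<bar> \<le> L * ((\<bar>t' - t\<bar> + 2 * \<tau>)\<^sup>2 + \<tau>)"
        by (simp add: d_def algebra_simps)
      have "c / sqrt (1 - c\<^sup>2) + real k * T * (A + A') \<le> L" using bounds_nonneg by (simp add: L_def)
      with Pb[of ?i] show "\<bar>p t\<bar> \<le> L" unfolding p_def by (rule order_trans)
    qed
  next
    fix t
    have "\<bar>x (fl t) - x 0\<bar> \<le> \<bar>of_int (fl t) * \<tau>\<bar>"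
      using x_diff[of "fl t" 0] tau(1) by (simp add: abs_mult)
    moreover have "\<bar>of_int (fl t) * \<tau>\<bar> \<le> \<bar>t\<bar> + T" using fl[of t] tau(3) by linarith
    moreover have "\<bar>x 0\<bar> \<le> 1" using x0 by simp
    ultimately show "\<bar>q t\<bar> \<le> 1 + T + \<bar>t\<bar>" unfolding q_def by linarith
  next
    fix a b t assume "a * r + b * s > 0"
    from order[OF this, of "fl t"] have "x (fl t) \<le> x (fl t + a * N) + of_int b" .
    moreover have "fl (t + of_int a * T) = fl t + a * N"
    proof -
      have "of_int a * T = of_int (a * N) * \<tau>" unfolding tau(2)[symmetric] by simp
      then have "(t + of_int a * T) / \<tau> = t / \<tau> + of_int (a * N)"
        using tau(1) by (simp only: add_divide_distrib) simp
      then show ?thesis unfolding fl_def by (simp only: floor_add_int)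
    qed
    ultimately show "q t \<le> q (t + of_int a * T) + of_int b" by (simp add: q_def)
  qed
qed

text \<open>
Approximation of \<open>\<omega>\<close> by rationals \<open>\<rho> n > \<omega>\<close>, with step sizes tending to zero. If
\<open>a * \<omega> + b = 0\<close> and \<open>a > 0\<close>, then \<open>a * \<rho> n + b > 0\<close> for all \<open>n\<close>, so the order relation
holds in the limit as well.
\<close>

lemma ordered_trajectory:
  assumes \<omega>: "\<bar>\<omega>\<bar> < T"
  obtains L q p where "approx_trajectory L 0 q p"
    "\<And>a b t. of_int a * \<omega> + of_int b > 0 \<or> of_int a * \<omega> + of_int b = 0 \<and> a > 0
      \<Longrightarrow> q t \<le> q (t + of_int a * T) + of_int b"
proof -
  \<comment> \<open>\<open>w\<close> bounds all approximating rotation numbers, and \<open>c\<close> leaves room between \<open>w / T\<close> and 1;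
    then \<open>k\<close> is chosen such that \<open>k * w + 1 < c * k * T\<close>.\<close>
  define w where "w = max \<bar>\<omega>\<bar> \<bar>(\<omega> + T) / 2\<bar>"
  have w: "0 \<le> w" "w < T" using \<omega> by (auto simp: w_def)
  define c where "c = (w / T + 1) / 2"
  have c: "0 \<le> c" "c < 1" "w < c * T" using w T_pos by (auto simp: c_def field_simps)
  obtain k :: nat where k: "1 < real k * (c * T - w)"
    using ex_less_of_nat_mult[of "c * T - w" 1] c by auto
  then have k0: "k > 0" by (cases "k = 0") auto
  define L where "L = 1 + K + A + 2 * A' + (c / sqrt (1 - c\<^sup>2) + real k * T * (A + A'))"
  \<comment> \<open>At least two steps per period are needed, hence the offset.\<close>
  define \<eta> where "\<eta> n = T / of_int (int n + 2)" for n
  have "\<exists>\<rho> q p. (\<omega> < \<rho> \<and> \<rho> < \<omega> + 1 / real (Suc n)) \<and> approx_trajectory L (\<eta> n) q p \<and>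
      (\<forall>t. \<bar>q t\<bar> \<le> 1 + T + \<bar>t\<bar>) \<and>
      (\<forall>a b t. of_int a * \<rho> + of_int b > 0 \<longrightarrow> q t \<le> q (t + of_int a * T) + of_int b)" for n
  proof -
    have "\<omega> < min (\<omega> + 1 / real (Suc n)) ((\<omega> + T) / 2)" using \<omega> by auto
    then obtain \<rho> where \<rho>: "\<rho> \<in> \<rat>" "\<omega> < \<rho>" "\<rho> < min (\<omega> + 1 / real (Suc n)) ((\<omega> + T) / 2)"
      using Rats_dense_in_real by blast
    from \<rho>(1) obtain r s :: int where rs: "s > 0" "\<rho> = of_int r / of_int s"
      by (rule Rats_cases')
    have "\<rho> < (\<omega> + T) / 2" using \<rho>(3) by simp
    then have "\<bar>\<rho>\<bar> \<le> w" using \<rho>(2) unfolding w_def le_max_iff_disj by linarith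
    then have "real k * \<bar>\<rho>\<bar> \<le> real k * w" by (intro mult_left_mono) auto
    then have slow: "real k * \<bar>of_int r / of_int s\<bar> + 1 < c * real k * T"
      using k unfolding rs(2) by (simp add: right_diff_distrib mult_ac)
    obtain q p where qp: "approx_trajectory L (\<eta> n) q p" "\<And>t. \<bar>q t\<bar> \<le> 1 + T + \<bar>t\<bar>"
      "\<And>a b t. a * r + b * s > 0 \<Longrightarrow> q t \<le> q (t + of_int a * T) + of_int b"
      using approx_orbit[OF _ rs(1) c(1,2) k0 slow, of "int n + 2"] unfolding L_def \<eta>_def by auto
    have "a * r + b * s > 0" if "of_int a * \<rho> + of_int b > 0" for a b
    proof -
      have "(of_int a * \<rho> + of_int b) * of_int s = real_of_int (a * r + b * s)"
        using rs by (simp add: distrib_right)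
      moreover have "(of_int a * \<rho> + of_int b) * of_int s > 0" using that rs(1) by simp
      ultimately show ?thesis by (simp only: of_int_0_less_iff)
    qed
    then show ?thesis using \<rho> qp by (intro exI[of _ \<rho>] exI[of _ q] exI[of _ p]) auto
  qed
  then obtain \<rho> Q P where \<rho>: "\<And>n. \<omega> < \<rho> n" "\<And>n. \<rho> n < \<omega> + 1 / real (Suc n)"
    and traj: "\<And>n. approx_trajectory L (\<eta> n) (Q n) (P n)"
    and bound: "\<And>n t. \<bar>Q n t\<bar> \<le> 1 + T + \<bar>t\<bar>"
    and order: "\<And>n a b t. of_int a * \<rho> n + of_int b > 0 \<Longrightarrow> Q n t \<le> Q n (t + of_int a * T) + of_int b"
    by metis
  obtain F1 q where F1: "F1 \<le> sequentially" "F1 \<noteq> bot" and q: "\<And>t. ((\<lambda>n. Q n t) \<longlongrightarrow> q t) F1"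
    using pointwise_cluster[of sequentially Q "\<lambda>t. 1 + T + \<bar>t\<bar>"] bound by auto
  have "\<forall>\<^sub>F n in F1. \<forall>t. \<bar>P n t\<bar> \<le> L" using traj unfolding approx_trajectory_def by simp
  then obtain F2 p where F2: "F2 \<le> F1" "F2 \<noteq> bot" and p: "\<And>t. ((\<lambda>n. P n t) \<longlongrightarrow> p t) F2"
    using pointwise_cluster[OF F1(2), of P "\<lambda>_. L"] by blast
  have q: "((\<lambda>n. Q n t) \<longlongrightarrow> q t) F2" for t using tendsto_mono[OF F2(1) q] .
  have seq: "F2 \<le> sequentially" using F1 F2 by simp
  have "\<eta> \<longlonglongrightarrow> 0"
  proof -
    have "(\<lambda>n. T * inverse (real (Suc (Suc n)))) \<longlonglongrightarrow> T * 0"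
      by (intro tendsto_mult tendsto_const LIMSEQ_Suc[OF LIMSEQ_inverse_real_of_nat])
    then show ?thesis by (simp add: \<eta>_def[abs_def] divide_inverse add.commute)
  qed
  then have "(\<eta> \<longlongrightarrow> 0) F2" using tendsto_mono[OF seq] by blast
  then have "approx_trajectory L 0 q p"
    using approx_trajectory_limit[OF F2(2) _ q p] traj by simp
  moreover have "q t \<le> q (t + of_int a * T) + of_int b"
    if ab: "of_int a * \<omega> + of_int b > 0 \<or> of_int a * \<omega> + of_int b = 0 \<and> a > 0" for a b t
  proof (rule tendsto_le[OF F2(2) tendsto_add[OF q tendsto_const] q])
    have "\<rho> \<longlonglongrightarrow> \<omega>"
    proof (rule tendsto_sandwich[of "\<lambda>_. \<omega>" _ _ "\<lambda>n. \<omega> + 1 / real (Suc n)"])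
      show "(\<lambda>n. \<omega> + 1 / real (Suc n)) \<longlonglongrightarrow> \<omega>"
        using tendsto_add[OF tendsto_const[of \<omega>] LIMSEQ_Suc[OF lim_1_over_n]] by simp
    qed (intro always_eventually allI less_imp_le \<rho> tendsto_const)+
    then have lim: "(\<lambda>n. of_int a * \<rho> n + of_int b) \<longlonglongrightarrow> of_int a * \<omega> + of_int b"
      by (intro tendsto_intros)
    have "\<forall>\<^sub>F n in sequentially. of_int a * \<rho> n + of_int b > 0"
      using ab
    proof
      assume "of_int a * \<omega> + of_int b > 0"
      with lim show ?thesis by (rule order_tendstoD(1))
    next
      assume *: "of_int a * \<omega> + of_int b = 0 \<and> a > 0"
      then have "of_int a * \<omega> < of_int a * \<rho> n" for n using \<rho>(1) by simp
      then have "of_int a * \<rho> n + of_int b > 0" for n using * by (metis add_less_cancel_right)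
      then show ?thesis by simp
    qed
    from filter_leD[OF seq this] show "\<forall>\<^sub>F n in F2. Q n t \<le> Q n (t + of_int a * T) + of_int b"
      by eventually_elim (rule order)
  qed
  ultimately show ?thesis using that by blast
qed

end

section \<open>Properties of trajectories\<close>

context forced_system
begin

lemma trajectory_deriv:
  assumes "approx_trajectory L 0 q p"
  shows "(q has_real_derivative vel (p t)) (at t)"
    and "(p has_real_derivative g (q t) + f t) (at t)"
proof -
  show "(q has_real_derivative vel (p t)) (at t)"
    using assms by (intro quadratic_remainder_imp_DERIV[of _ _ _ L]) (simp add: approx_trajectory_def)
  have "((\<lambda>t. p t - F t) has_real_derivative g (q t)) (at t)"
    using assms by (intro quadratic_remainder_imp_DERIV[of _ _ _ L])
      (simp add: approx_trajectory_def algebra_simps)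
  from DERIV_add[OF this F_deriv[of t]] show "(p has_real_derivative g (q t) + f t) (at t)" by simp
qed

lemma trajectory_solves:
  assumes "approx_trajectory L 0 q p"
  shows "solves_system g f q p"
  using trajectory_deriv[OF assms] unfolding solves_system_def vel_def by blast

text \<open>
The velocity determines the momentum.
\<close>

lemma trajectory_momentum_unique:
  assumes "approx_trajectory L 0 q p" "approx_trajectory L' 0 q p'"
  shows "p = p'"
proof
  fix t
  have "vel (p t) = vel (p' t)"
    using trajectory_deriv(1)[OF assms(1)] trajectory_deriv(1)[OF assms(2)] by (rule DERIV_unique)
  then show "p t = p' t" using strict_mono_eq[OF vel_strict_mono] by blast
qed

lemma trajectory_translate:
  assumes "approx_trajectory L 0 q p"
  shows "approx_trajectory L 0 (\<lambda>t. q (t + of_int a * T) + of_int b) (\<lambda>t. p (t + of_int a * T))"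
proof -
  have "F (t + of_int a * T) = F t" "g (y + of_int b) = g y" for t y
    using periodic_int[of F T t a, OF F_periodic] periodic_int[of g 1 y b, OF g_periodic] by simp_all
  moreover have "t' + of_int a * T - (t + of_int a * T) = t' - t" for t t' by simp
  ultimately show ?thesis
    using assms unfolding approx_trajectory_def
    by (metis (no_types, opaque_lifting) add_diff_cancel_right)
qed

lemma trajectory_speed:
  assumes "approx_trajectory L 0 q p"
  shows "\<bar>q t - q t'\<bar> \<le> \<bar>t - t'\<bar>"
  using DERIV_bound_imp_Lipschitz[OF trajectory_deriv(1)[OF assms], of 1 t t'] vel_bound
  by (simp add: less_imp_le)

text \<open>
Let \<open>u\<close> and \<open>z\<close> be the differences of positions and momenta. By the mean value theorem the
increment of \<open>u\<close> over \<open>{0..\<delta>}\<close> bounds \<open>z\<close> at one intermediate time; elsewhere \<open>z\<close> differs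
from that value by at most \<open>K * \<delta> * sup \<bar>u\<bar>\<close>. Since \<open>u\<close> varies at most at the rate \<open>\<bar>z\<bar>\<close>, the
choice \<open>K * \<delta>\<^sup>2 \<le> 1 / 2\<close> allows \<open>sup \<bar>u\<bar>\<close> to be absorbed. The bound \<open>L\<close> on the momenta
enters through the least slope \<open>m\<close> of the velocity.
\<close>

lemma momentum_controlled_by_positions:
  fixes L \<delta> :: real
  assumes q: "approx_trajectory L 0 q p" "approx_trajectory L 0 q' p'"
  defines "\<delta> \<equiv> 1 / (2 * K + 2)" and "m \<equiv> 1 / sqrt (1 + L\<^sup>2) ^ 3"
  shows "\<bar>p' 0 - p 0\<bar> \<le> (1 + 2 * K * \<delta> * \<delta>) * ((\<bar>q' \<delta> - q \<delta>\<bar> + \<bar>q' 0 - q 0\<bar>) / (m * \<delta>)) + 2 * K * \<delta> * \<bar>q' 0 - q 0\<bar>"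
proof -
  define u where "u t = q' t - q t" for t
  define z where "z t = p' t - p t" for t
  have u': "(u has_real_derivative vel (p' t) - vel (p t)) (at t)" for t
    unfolding u_def by (intro DERIV_diff trajectory_deriv(1)[OF q(1)] trajectory_deriv(1)[OF q(2)])
  have z': "(z has_real_derivative g (q' t) - g (q t)) (at t)" for t
    using DERIV_diff[OF trajectory_deriv(2)[OF q(2), of t] trajectory_deriv(2)[OF q(1), of t]]
    unfolding z_def by simp
  have K: "K \<ge> 0" by (rule bounds_nonneg)
  have del: "\<delta> > 0" "K * \<delta> * \<delta> \<le> 1 / 2" "\<delta> \<le> 1"
  proof -
    show "\<delta> > 0" "\<delta> \<le> 1" using K by (auto simp: \<delta>_def divide_le_eq)
    moreover have "K * \<delta> \<le> 1 / 2" using K by (simp add: \<delta>_def divide_le_eq)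
    ultimately show "K * \<delta> * \<delta> \<le> 1 / 2" using K mult_mono[of "K * \<delta>" "1 / 2" \<delta> 1] by simp
  qed
  have m: "m > 0" by (simp add: m_def add_pos_nonneg)
  have pL: "\<bar>p t\<bar> \<le> L" "\<bar>p' t\<bar> \<le> L" for t using q by (auto simp: approx_trajectory_def)
  have "continuous_on {0..\<delta>} (\<lambda>t. \<bar>u t\<bar>)"
    using u' by (intro continuous_on_rabs DERIV_continuous_on) (auto intro: has_field_derivative_at_within)
  then obtain s where s: "s \<in> {0..\<delta>}" "\<And>t. t \<in> {0..\<delta>} \<Longrightarrow> \<bar>u t\<bar> \<le> \<bar>u s\<bar>"
    using continuous_attains_sup[of "{0..\<delta>}" "\<lambda>t. \<bar>u t\<bar>"] del by auto
  define U where "U = \<bar>u s\<bar>"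
  have U: "U \<ge> 0" by (simp add: U_def)
  have z_var: "\<bar>z t - z t'\<bar> \<le> K * \<delta> * U" if "t \<in> {0..\<delta>}" "t' \<in> {0..\<delta>}" for t t'
  proof -
    have "norm (z t - z t') \<le> (K * U) * norm (t - t')"
    proof (rule field_differentiable_bound[of "{0..\<delta>}" z "\<lambda>t. g (q' t) - g (q t)"])
      fix y assume y: "y \<in> {0..\<delta>}"
      show "(z has_real_derivative g (q' y) - g (q y)) (at y within {0..\<delta>})"
        using z' by (rule has_field_derivative_at_within)
      have "\<bar>g (q' y) - g (q y)\<bar> \<le> K * \<bar>u y\<bar>" unfolding u_def by (rule g_Lipschitz)
      also have "\<dots> \<le> K * U" using s(2)[OF y] K by (simp add: U_def mult_left_mono)
      finally show "norm (g (q' y) - g (q y)) \<le> K * U" by simp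
    qed (use that in auto)
    also have "\<dots> \<le> (K * U) * \<delta>" using that K U by (intro mult_left_mono) auto
    finally show ?thesis by (simp add: mult_ac)
  qed
  define E where "E = (\<bar>u \<delta>\<bar> + \<bar>u 0\<bar>) / (m * \<delta>)"
  have E: "E \<ge> 0" using m del by (simp add: E_def)
  obtain t1 where t1: "0 < t1" "t1 < \<delta>" "u \<delta> - u 0 = (\<delta> - 0) * (vel (p' t1) - vel (p t1))"
    using MVT2[OF del(1), of u "\<lambda>t. vel (p' t) - vel (p t)"] u' by blast
  obtain c where c: "m \<le> c" "vel (p' t1) - vel (p t1) = c * z t1"
    using vel_mean_value[OF pL(1)[of t1] pL(2)[of t1]] unfolding m_def z_def by blast
  have zt1: "\<bar>z t1\<bar> \<le> E"
  proof -
    have "\<bar>z t1\<bar> * (m * \<delta>) \<le> \<bar>z t1\<bar> * (c * \<delta>)" using c del by (intro mult_left_mono mult_right_mono) auto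
    also have "\<dots> = \<bar>u \<delta> - u 0\<bar>" using t1(3) c del m by (simp add: abs_mult)
    also have "\<dots> \<le> \<bar>u \<delta>\<bar> + \<bar>u 0\<bar>" by simp
    finally show ?thesis using m del by (simp add: E_def pos_le_divide_eq)
  qed
  have zE: "\<bar>z t\<bar> \<le> E + K * \<delta> * U" if "t \<in> {0..\<delta>}" for t
    using z_var[OF that, of t1] t1 zt1 by auto
  have "norm (u s - u 0) \<le> (E + K * \<delta> * U) * norm (s - 0)"
  proof (rule field_differentiable_bound[of "{0..\<delta>}" u "\<lambda>t. vel (p' t) - vel (p t)"])
    fix y assume y: "y \<in> {0..\<delta>}"
    show "(u has_real_derivative vel (p' y) - vel (p y)) (at y within {0..\<delta>})"
      using u' by (rule has_field_derivative_at_within)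
    show "norm (vel (p' y) - vel (p y)) \<le> E + K * \<delta> * U"
      using vel_Lipschitz[of "p' y" "p y"] zE[OF y] by (simp add: z_def)
  qed (use s del in auto)
  also have "\<dots> \<le> (E + K * \<delta> * U) * \<delta>" using s(1) E K U del by (intro mult_left_mono) auto
  finally have "U \<le> \<bar>u 0\<bar> + (E * \<delta> + (K * \<delta> * \<delta>) * U)" by (simp add: U_def algebra_simps)
  also have "(K * \<delta> * \<delta>) * U \<le> (1 / 2) * U" using del(2) U by (rule mult_right_mono)
  finally have "U \<le> 2 * (\<bar>u 0\<bar> + E * \<delta>)" by simp
  then have "K * \<delta> * U \<le> K * \<delta> * (2 * (\<bar>u 0\<bar> + E * \<delta>))" using K del by (intro mult_left_mono) auto
  then have "\<bar>z 0\<bar> \<le> E + K * \<delta> * (2 * (\<bar>u 0\<bar> + E * \<delta>))"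
    using zE[of 0] del by simp
  also have "\<dots> = (1 + 2 * K * \<delta> * \<delta>) * E + 2 * K * \<delta> * \<bar>u 0\<bar>" by (simp add: algebra_simps)
  finally show ?thesis unfolding E_def u_def z_def .
qed

end

section \<open>The family of solutions\<close>

lemma ratio_limit_of_bounded_deviation:
  fixes h :: "real \<Rightarrow> real"
  assumes "\<And>t. \<bar>h t - v * t\<bar> \<le> B"
  shows "((\<lambda>t. h t / t) \<longlongrightarrow> v) at_top"
proof -
  have "((\<lambda>t. (h t - v * t) / t) \<longlongrightarrow> 0) at_top"
  proof (rule Lim_null_comparison)
    show "\<forall>\<^sub>F t in at_top. norm ((h t - v * t) / t) \<le> B / t"
      using eventually_gt_at_top[of 0] by eventually_elim (simp add: divide_right_mono assms abs_divide)
    show "((\<lambda>t. B / t) \<longlongrightarrow> 0) at_top"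
      by (intro real_tendsto_divide_at_top[of _ B] tendsto_const filterlim_ident)
  qed
  from tendsto_add[OF this tendsto_const[of v]]
  have "((\<lambda>t. (h t - v * t) / t + v) \<longlongrightarrow> v) at_top" by simp
  moreover have "\<forall>\<^sub>F t in at_top. (h t - v * t) / t + v = h t / t"
    using eventually_gt_at_top[of 0] by eventually_elim (simp add: field_simps)
  ultimately show ?thesis by (rule Lim_transform_eventually)
qed

text \<open>
The lexicographic condition compares every nontrivial translate with \<open>q0\<close>, also when
\<open>\<omega>\<close> is rational and \<open>a * \<omega> + b\<close> vanishes for some \<open>a \<noteq> 0\<close>.
\<close>

locale ordered_orbit = forced_system +
  fixes \<omega> L :: real and q0 p0 :: "real \<Rightarrow> real"
  assumes trajectory: "approx_trajectory L 0 q0 p0"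
    and order: "of_int a * \<omega> + of_int b > 0 \<or> of_int a * \<omega> + of_int b = 0 \<and> a > 0
      \<Longrightarrow> q0 t \<le> q0 (t + of_int a * T) + of_int b"
begin

definition translate :: "int \<times> int \<Rightarrow> real \<Rightarrow> real" where
  "translate = (\<lambda>(a, b) t. q0 (t + of_int a * T) + of_int b)"

definition above :: "real \<Rightarrow> (int \<times> int) set" where
  "above \<xi> = {(a, b). of_int a * \<omega> + of_int b > \<xi>}"

text \<open>
Indexing the infimum by \<open>a * \<omega> + b > \<xi>\<close> turns translations of \<open>\<xi>\<close> by 1 and by \<open>\<omega>\<close> into
shifts of the index set. This makes the translation laws hold for every \<open>\<xi>\<close>, including points
of discontinuity.
\<close>

definition hull_pos :: "real \<Rightarrow> real \<Rightarrow> real" where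
  "hull_pos \<xi> t = (INF u\<in>translate ` above \<xi>. u t)"

lemma above_nonempty: "translate ` above \<xi> \<noteq> {}"
proof -
  have "(0, \<lfloor>\<xi>\<rfloor> + 1) \<in> above \<xi>" by (simp add: above_def)
  then show ?thesis by blast
qed

lemma translate_lower:
  assumes "d \<in> above \<xi>"
  shows "q0 t + of_int \<lfloor>\<xi>\<rfloor> \<le> translate d t"
proof -
  obtain a b where d: "d = (a, b)" "of_int a * \<omega> + of_int b > \<xi>" using assms by (auto simp: above_def)
  then have "of_int a * \<omega> + of_int (b - \<lfloor>\<xi>\<rfloor>) > 0"
    using of_int_floor_le[of \<xi>] unfolding of_int_diff by linarith
  with order[of a "b - \<lfloor>\<xi>\<rfloor>" t] show ?thesis by (simp add: d translate_def)
qed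

lemma translates_bdd_below: "bdd_below ((\<lambda>u. u t) ` translate ` above \<xi>)"
  by (rule bdd_belowI[of _ "q0 t + of_int \<lfloor>\<xi>\<rfloor>"]) (use translate_lower in auto)

lemma translates_chain:
  assumes "u \<in> range translate" "v \<in> range translate"
  shows "u \<le> v \<or> v \<le> u"
proof -
  obtain a b a' b' where uv: "u = translate (a, b)" "v = translate (a', b')"
    using assms by (auto simp: image_iff)
  have le: "translate (a', b') \<le> translate (a, b)"
    if "of_int (a - a') * \<omega> + of_int (b - b') > 0 \<or> of_int (a - a') * \<omega> + of_int (b - b') = 0 \<and> a - a' > 0"
    for a b a' b'
  proof (rule le_funI)
    fix t
    have "t + of_int a' * T + of_int (a - a') * T = t + of_int a * T" by (simp add: algebra_simps)
    then have "q0 (t + of_int a' * T) \<le> q0 (t + of_int a * T) + of_int (b - b')"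
      using order[OF that, of "t + of_int a' * T"] by (simp only:)
    then show "translate (a', b') t \<le> translate (a, b) t" by (simp add: translate_def)
  qed
  define z where "z = of_int (a - a') * \<omega> + of_int (b - b')"
  have minus: "of_int (a' - a) * \<omega> + of_int (b' - b) = - z" by (simp add: z_def algebra_simps)
  consider "z > 0 \<or> z = 0 \<and> a - a' > 0" | "- z > 0 \<or> - z = 0 \<and> a' - a > 0" | "z = 0" "a = a'"
    by linarith
  then show ?thesis
  proof cases
    case 1
    then have "v \<le> u" unfolding uv z_def by (rule le)
    then show ?thesis ..
  next
    case 2
    then have "u \<le> v" unfolding uv minus[symmetric] by (rule le)
    then show ?thesis ..
  next
    case 3
    then show ?thesis by (simp add: uv z_def)
  qed
qed

lemma hull_pos_le:
  assumes "of_int a * \<omega> + of_int b > \<xi>"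
  shows "hull_pos \<xi> t \<le> q0 (t + of_int a * T) + of_int b"
proof -
  have "translate (a, b) \<in> translate ` above \<xi>" using assms by (auto simp: above_def)
  from cINF_lower[OF translates_bdd_below this] show ?thesis by (simp add: hull_pos_def translate_def)
qed

lemma hull_pos_greatest:
  assumes "\<And>a b. of_int a * \<omega> + of_int b > \<xi> \<Longrightarrow> m \<le> q0 (t + of_int a * T) + of_int b"
  shows "m \<le> hull_pos \<xi> t"
  unfolding hull_pos_def
  by (rule cINF_greatest[OF above_nonempty]) (use assms in \<open>auto simp: above_def translate_def\<close>)

lemma hull_pos_mono:
  assumes "\<xi> \<le> \<xi>'"
  shows "hull_pos \<xi> t \<le> hull_pos \<xi>' t"
  by (rule hull_pos_greatest) (use assms in \<open>auto intro: hull_pos_le\<close>)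

lemma hull_pos_translate:
  "hull_pos (\<xi> + of_int a * \<omega> + of_int b) t = hull_pos \<xi> (t + of_int a * T) + of_int b"
proof -
  have le: "hull_pos (\<xi> + of_int a * \<omega> + of_int b) t \<le> hull_pos \<xi> (t + of_int a * T) + of_int b" for \<xi> a b t
  proof -
    have "hull_pos (\<xi> + of_int a * \<omega> + of_int b) t - of_int b \<le> hull_pos \<xi> (t + of_int a * T)"
    proof (rule hull_pos_greatest)
      fix c d :: int assume "of_int c * \<omega> + of_int d > \<xi>"
      then have "hull_pos (\<xi> + of_int a * \<omega> + of_int b) t \<le> q0 (t + of_int (a + c) * T) + of_int (b + d)"
        by (intro hull_pos_le) (simp add: distrib_right)
      then show "hull_pos (\<xi> + of_int a * \<omega> + of_int b) t - of_int b
          \<le> q0 (t + of_int a * T + of_int c * T) + of_int d"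
        by (simp add: distrib_right add.assoc)
    qed
    then show ?thesis by simp
  qed
  have "hull_pos (\<xi> + of_int a * \<omega> + of_int b + of_int (- a) * \<omega> + of_int (- b)) (t + of_int a * T)
      \<le> hull_pos (\<xi> + of_int a * \<omega> + of_int b) (t + of_int a * T + of_int (- a) * T) + of_int (- b)"
    by (rule le)
  then have "hull_pos \<xi> (t + of_int a * T) \<le> hull_pos (\<xi> + of_int a * \<omega> + of_int b) t - of_int b"
    by simp
  with le[of \<xi> a b t] show ?thesis by linarith
qed

text \<open>
The infimum is a limit of translates along one filter for all times, and a finer filter makes
their momenta converge as well.
\<close>

lemma hull_momentum_exists: "\<exists>p. approx_trajectory L 0 (hull_pos \<xi>) p"
proof -
  have chain: "u \<le> v \<or> v \<le> u" if "u \<in> translate ` above \<xi>" "v \<in> translate ` above \<xi>" for u v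
    by (rule translates_chain) (use that in auto)
  obtain F where F: "F \<noteq> bot" "\<forall>\<^sub>F u in F. u \<in> translate ` above \<xi>"
    and lim: "\<And>t. ((\<lambda>u. u t) \<longlongrightarrow> hull_pos \<xi> t) F"
    using chain_Inf_limit[OF above_nonempty chain translates_bdd_below] unfolding hull_pos_def by blast
  have "\<forall>u\<in>translate ` above \<xi>. \<exists>p. approx_trajectory L 0 u p"
    using trajectory_translate[OF trajectory] by (auto simp: translate_def)
  then obtain P where P: "\<And>u. u \<in> translate ` above \<xi> \<Longrightarrow> approx_trajectory L 0 u (P u)"
    by metis
  have traj: "\<forall>\<^sub>F u in F. approx_trajectory L 0 u (P u)"
    using F(2) by eventually_elim (rule P)
  then have "\<forall>\<^sub>F u in F. \<forall>t. \<bar>P u t\<bar> \<le> L"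
    by eventually_elim (auto simp: approx_trajectory_def)
  then obtain F' p where F': "F' \<le> F" "F' \<noteq> bot" and p: "\<And>t. ((\<lambda>u. P u t) \<longlongrightarrow> p t) F'"
    using pointwise_cluster[OF F(1), of P "\<lambda>_. L"] by blast
  have "approx_trajectory L 0 (hull_pos \<xi>) p"
    using approx_trajectory_limit[where Q = "\<lambda>u. u" and P = P and \<eta> = "\<lambda>_. 0", OF F'(2) tendsto_const
        tendsto_mono[OF F'(1) lim] p filter_leD[OF F'(1) traj]] .
  then show ?thesis by blast
qed

definition hull_mom :: "real \<Rightarrow> real \<Rightarrow> real" where
  "hull_mom \<xi> = (SOME p. approx_trajectory L 0 (hull_pos \<xi>) p)"

lemma hull_trajectory: "approx_trajectory L 0 (hull_pos \<xi>) (hull_mom \<xi>)"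
  unfolding hull_mom_def by (rule someI_ex[OF hull_momentum_exists])

text \<open>
Positions satisfy this law, and they determine the momenta.
\<close>

lemma hull_mom_translate:
  "hull_mom (\<xi> + of_int a * \<omega> + of_int b) t = hull_mom \<xi> (t + of_int a * T)"
proof -
  have "hull_pos (\<xi> + of_int a * \<omega> + of_int b) = (\<lambda>t. hull_pos \<xi> (t + of_int a * T) + of_int b)"
    using hull_pos_translate by blast
  then have "approx_trajectory L 0 (hull_pos (\<xi> + of_int a * \<omega> + of_int b)) (\<lambda>t. hull_mom \<xi> (t + of_int a * T))"
    using trajectory_translate[OF hull_trajectory] by simp
  from trajectory_momentum_unique[OF hull_trajectory this] show ?thesis by (simp add: fun_eq_iff)
qed

text \<open>
Write \<open>t = t' + a * T\<close> with \<open>0 \<le> t' < T\<close>. Advancing by \<open>a\<close> periods adds \<open>a * \<omega>\<close> to \<open>\<xi>\<close>, which by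
monotonicity and 1-periodicity moves the position by \<open>a * \<omega>\<close> up to an error of 1.
\<close>

lemma hull_pos_deviation: "\<bar>hull_pos \<xi> t - \<omega> / T * t\<bar> \<le> \<bar>hull_pos \<xi> 0\<bar> + T + \<bar>\<omega>\<bar> + 1"
proof -
  define a where "a = \<lfloor>t / T\<rfloor>"
  define t' where "t' = t - of_int a * T"
  have t': "0 \<le> t'" "t' < T" 
  proof -
    have "of_int a * T \<le> t"
      using T_pos of_int_floor_le[of "t / T"] unfolding a_def by (simp only: pos_le_divide_eq)
    moreover have "t < (of_int a + 1) * T"
      using T_pos real_of_int_floor_add_one_gt[of "t / T"] unfolding a_def by (simp only: pos_divide_less_eq)
    ultimately show "0 \<le> t'" "t' < T" by (simp_all add: t'_def distrib_right)
  qed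
  define v where "v = of_int a * \<omega>"
  have t: "t' + of_int a * T = t" by (simp add: t'_def)
  have per: "hull_pos (\<xi> + of_int n) t' = hull_pos \<xi> t' + of_int n" for n
    using hull_pos_translate[of \<xi> 0 n t'] by simp
  have "hull_pos \<xi> t = hull_pos (\<xi> + v) t'"
    using hull_pos_translate[of \<xi> a 0 t'] by (simp add: v_def t)
  moreover have "hull_pos (\<xi> + of_int \<lfloor>v\<rfloor>) t' \<le> hull_pos (\<xi> + v) t'"
    by (rule hull_pos_mono) simp
  moreover have "hull_pos (\<xi> + v) t' \<le> hull_pos (\<xi> + of_int (\<lfloor>v\<rfloor> + 1)) t'"
    by (rule hull_pos_mono) (use real_of_int_floor_add_one_ge[of v] in simp)
  ultimately have "\<bar>hull_pos \<xi> t - hull_pos \<xi> t' - v\<bar> \<le> 1"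
    unfolding per by linarith
  moreover have "\<bar>hull_pos \<xi> t' - hull_pos \<xi> 0\<bar> \<le> T"
    using trajectory_speed[OF hull_trajectory, of \<xi> t' 0] t' by simp
  moreover have "\<bar>\<omega> / T * t'\<bar> \<le> \<bar>\<omega>\<bar>"
  proof -
    have "\<bar>\<omega> / T * t'\<bar> = \<bar>\<omega>\<bar> * (t' / T)" using t' T_pos by (simp add: abs_mult)
    also have "\<dots> \<le> \<bar>\<omega>\<bar> * 1" using t' T_pos by (intro mult_left_mono) auto
    finally show ?thesis by simp
  qed
  moreover have "\<omega> / T * t = \<omega> / T * t' + v"
    using T_pos by (simp add: v_def t'_def right_diff_distrib)
  ultimately show ?thesis by linarith
qed

lemma hull_mom_bounded_variation: "locally_bounded_variation (\<lambda>\<xi>. hull_mom \<xi> 0)"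
proof -
  define \<delta> where "\<delta> = 1 / (2 * K + 2)"
  define C1 where "C1 = (1 + 2 * K * \<delta> * \<delta>) / ((1 / sqrt (1 + L\<^sup>2) ^ 3) * \<delta>)"
  define C2 where "C2 = 2 * K * \<delta>"
  show ?thesis
  proof (rule mono_bound_imp_bounded_variation)
    fix x y :: real assume "x \<le> y"
    then have mono: "hull_pos x t \<le> hull_pos y t" for t by (rule hull_pos_mono)
    have "\<bar>hull_mom y 0 - hull_mom x 0\<bar> \<le> C1 * (\<bar>hull_pos y \<delta> - hull_pos x \<delta>\<bar> + \<bar>hull_pos y 0 - hull_pos x 0\<bar>)
        + C2 * \<bar>hull_pos y 0 - hull_pos x 0\<bar>"
      using momentum_controlled_by_positions[OF hull_trajectory hull_trajectory, of y x]
      unfolding C1_def C2_def \<delta>_def[symmetric] by (simp only: times_divide_eq_left times_divide_eq_right)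
    then show "\<bar>hull_mom y 0 - hull_mom x 0\<bar>
        \<le> (C1 * (hull_pos y \<delta> + hull_pos y 0) + C2 * hull_pos y 0) - (C1 * (hull_pos x \<delta> + hull_pos x 0) + C2 * hull_pos x 0)"
      using mono by (simp add: abs_of_nonneg algebra_simps)
  qed
qed

end

theorem theorem3:
  fixes T \<omega> :: real and f g :: "real \<Rightarrow> real"
  assumes "T > 0"
    and "C_k 7 g"
    and "\<And>x. g (x + 1) = g x"
    and "integral {0..1} g = 0"
    and "continuous_on UNIV f"
    and "\<And>t. f (t + T) = f t"
    and "integral {0..T} f = 0"
    and "\<omega> \<in> {-T<..<T}"
  shows "\<exists>q p :: real \<Rightarrow> real \<Rightarrow> real.
    (\<forall>\<xi>. solves_system g f (q \<xi>) (p \<xi>)) \<and>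
    (\<forall>\<xi> t. (q (\<xi> + 1) t, p (\<xi> + 1) t) = (q \<xi> t, p \<xi> t) + (1, 0)) \<and>
    (\<forall>\<xi> t. (q \<xi> (t + T), p \<xi> (t + T)) = (q (\<xi> + \<omega>) t, p (\<xi> + \<omega>) t)) \<and>
    locally_bounded_variation (\<lambda>\<xi>. q \<xi> 0) \<and>
    locally_bounded_variation (\<lambda>\<xi>. p \<xi> 0) \<and>
    (\<forall>\<xi>. ((\<lambda>t. q \<xi> t / t) \<longlongrightarrow> \<omega> / T) at_top)"
proof -
  have smooth: "(deriv ^^ j) g field_differentiable at x" if "j < 7" for j x
    using \<open>C_k 7 g\<close> that unfolding C_k_def by blast
  have g_deriv: "(g has_real_derivative deriv g x) (at x)" for x
    using smooth[of 0 x] by (simp add: DERIV_deriv_iff_field_differentiable)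
  then have g_cont: "continuous_on UNIV g"
    by (intro DERIV_continuous_on) (auto intro: has_field_derivative_at_within)
  have "deriv g field_differentiable at x" for x
    using smooth[of 1 x] by simp
  then have g'_cont: "continuous_on UNIV (deriv g)"
    by (auto intro!: continuous_at_imp_continuous_on field_differentiable_imp_continuous_at)
  have g'_per: "deriv g (x + 1) = deriv g x" for x
  proof -
    have "((\<lambda>y. g (y + 1)) has_real_derivative deriv g (x + 1)) (at x)"
      using g_deriv[of "x + 1"] by (simp add: DERIV_shift)
    then show ?thesis using assms(3) g_deriv[of x] by (simp add: DERIV_unique)
  qed
  obtain A where "\<And>x. \<bar>g x\<bar> \<le> A" using periodic_continuous_bounded[OF g_cont assms(3)] by auto
  moreover obtain K where "\<And>x. \<bar>deriv g x\<bar> \<le> K"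
    using periodic_continuous_bounded[OF g'_cont g'_per] by auto
  then have "\<bar>g x - g y\<bar> \<le> K * \<bar>x - y\<bar>" for x y by (rule DERIV_bound_imp_Lipschitz[OF g_deriv])
  moreover obtain A' where "\<And>t. \<bar>f t\<bar> \<le> A'"
    using periodic_continuous_bounded[OF assms(5,6,1)] by auto
  moreover obtain G where "\<And>x. (G has_real_derivative g x) (at x)" "\<And>x. G (x + 1) = G x"
    using antiderivative_periodic[OF g_cont assms(3) _ assms(4)] by auto
  moreover obtain F where "\<And>t. (F has_real_derivative f t) (at t)" "\<And>t. F (t + T) = F t"
    using antiderivative_periodic[OF assms(5,6,1,7)] by auto
  ultimately interpret forced_system T g f G F A A' K
    using assms(1,3) by unfold_locales auto
  have "\<bar>\<omega>\<bar> < T" using assms(8) by auto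
  then obtain L q0 p0 where "approx_trajectory L 0 q0 p0"
    "\<And>a b t. of_int a * \<omega> + of_int b > 0 \<or> of_int a * \<omega> + of_int b = 0 \<and> a > 0
      \<Longrightarrow> q0 t \<le> q0 (t + of_int a * T) + of_int b"
    using ordered_trajectory by blast
  then interpret ordered_orbit T g f G F A A' K \<omega> L q0 p0
    by unfold_locales auto
  show ?thesis
  proof (rule exI[of _ hull_pos], rule exI[of _ hull_mom], intro conjI allI)
    fix \<xi> t
    show "solves_system g f (hull_pos \<xi>) (hull_mom \<xi>)"
      by (rule trajectory_solves[OF hull_trajectory])
    show "(hull_pos (\<xi> + 1) t, hull_mom (\<xi> + 1) t) = (hull_pos \<xi> t, hull_mom \<xi> t) + (1, 0)"
      using hull_pos_translate[of \<xi> 0 1 t] hull_mom_translate[of \<xi> 0 1 t] by simp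
    show "(hull_pos \<xi> (t + T), hull_mom \<xi> (t + T)) = (hull_pos (\<xi> + \<omega>) t, hull_mom (\<xi> + \<omega>) t)"
      using hull_pos_translate[of \<xi> 1 0 t] hull_mom_translate[of \<xi> 1 0 t] by simp
    show "locally_bounded_variation (\<lambda>\<xi>. hull_pos \<xi> 0)"
      by (rule mono_locally_bounded_variation) (simp add: monoI hull_pos_mono)
    show "locally_bounded_variation (\<lambda>\<xi>. hull_mom \<xi> 0)"
      by (rule hull_mom_bounded_variation)
    show "((\<lambda>t. hull_pos \<xi> t / t) \<longlongrightarrow> \<omega> / T) at_top"
      by (rule ratio_limit_of_bounded_deviation[OF hull_pos_deviation])
  qed
qed

end
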